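(* As formal power series in $q$: (i) For every integer $k\ge 1$, $$H_{\Gamma_{3k+2}}(q)=q^{-1}\,\frac{\sum_{n\ge 1}\frac{n\binom{n+k-2}{k-1}q^n}{1-q^n}}{(q)_\infty^{k+1}},$$ where the numerator $\sum_{n\ge1}\frac{n\binom{n+k-2}{k-1}q^n}{1-q^n}$ is the logarithmic derivative (with respect to $q\frac{d}{dq}$) of $\prod_{n\ge 1}(1-q^n)^{-\binom{n+k-2}{k-1}}$. (ii) For every integer $k\ge 2$, $$H_{T_{2k+2}}(q)=q^{-1}\,\frac{\mathfrak z_q(k)}{(q)_\infty^{k+1}},\qquad \mathfrak z_q(k)=\sum_{n\ge1}\frac{q^n}{(1-q^n)^k}=\sum_{n\ge1}\frac{\binom{n+k-2}{k-1}q^n}{1-q^n}.$$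
   Context: Notation: $(q)_n=\prod_{j=1}^n(1-q^j)$, $(q)_\infty=\prod_{j\ge1}(1-q^j)$. Graph series: for a finite simple graph $\Gamma$ with vertices $1,\dots,r$ and adjacency matrix $A_\Gamma$, $$H_\Gamma(q)=\sum_{\mathbf n\in\mathbb Z_{\ge0}^r}\frac{q^{\frac12\mathbf n A_\Gamma\mathbf n^{\mathsf T}+n_1+\cdots+n_r}}{(q)_{n_1}\cdots(q)_{n_r}}$$ (so $\frac12\mathbf nA_\Gamma\mathbf n^{\mathsf T}=\sum_{\{i,j\}\text{ edge}}n_in_j$). The graph $\Gamma_{3k+2}$ ($k\ge1$) has vertices $1,2,\dots,3k+2$ and exactly the following edges: $1\sim2\sim3\sim4\sim5\sim1$; $i\sim i+1$ for $5\le i\le 3k+1$; $1\sim 3t+2$ and $4\sim 3t+2$ for $2\le t\le k$; and $3s+1\sim 3(\ell+1)+2$ for $2\le s\le \ell\le k-1$. The graph $T_{2k+2}$ is the star-shaped tree with vertices $1,\dots,2k+2$, central vertex $1$, having $k$ legs of length two and one leg of length one: its edges are $1\sim 2j$ and $2j\sim 2j+1$ for $1\le j\le k$, and $1\sim 2k+2$. *)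

theory Defs
  imports
    "HOL-Analysis.Infinite_Sum"
    "HOL-Analysis.Infinite_Products"
    "HOL-Computational_Algebra.Formal_Laurent_Series"
begin

text \<open>
  All series live in \<open>rat fps\<close> (all coefficients involved are rational integers), with the
  indeterminate \<open>q\<close> being \<^const>\<open>fps_X\<close>; \<open>infsum\<close> and \<open>prodinf\<close> refer to the
  \<open>q\<close>-adic topology. Since both functions return a default value when there is no convergence,
  convergence of every sum and product used below is proved here as well.
\<close>

lemma summable_on_fpsI:
  fixes F :: "'a \<Rightarrow> 'b :: ab_group_add fps"
  assumes "\<And>m. finite {x\<in>A. fps_nth (F x) m \<noteq> 0}"
  shows "F summable_on A"
proof -
  have "(F has_sum Abs_fps (\<lambda>m. \<Sum>x | x \<in> A \<and> fps_nth (F x) m \<noteq> 0. fps_nth (F x) m)) A"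
    by (rule has_sum_fpsI) (use assms in auto)
  thus ?thesis by (auto simp: summable_on_def)
qed

lemma fps_nth_X_power_div:
  fixes g :: "rat fps"
  assumes "fps_nth g 0 \<noteq> 0" "m < e"
  shows "fps_nth (fps_X ^ e / g) m = 0"
proof -
  have "fps_X ^ e / g = fps_X ^ e * inverse g"
    by (rule fps_divide_unit) (use assms in auto)
  thus ?thesis using assms by (simp add: fps_X_power_mult_nth)
qed


subsection \<open>The \<open>q\<close>-Pochhammer symbols\<close>

definition qpoch :: "nat \<Rightarrow> rat fps" where
  "qpoch n = (\<Prod>j=1..n. 1 - fps_X ^ j)"

definition qpoch_inf :: "rat fps" where
  "qpoch_inf = (\<Prod>j. 1 - fps_X ^ Suc j)"

lemma fps_nth_power_0: "fps_nth (f ^ n) 0 = (fps_nth f 0 :: 'a :: comm_semiring_1) ^ n"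
  by (induction n) auto

lemma qpoch_nth_0: "fps_nth (qpoch n) 0 = 1"
proof -
  have "fps_nth (\<Prod>j\<in>J. 1 - fps_X ^ j :: rat fps) 0 = 1" if "finite J" "0 \<notin> J" for J
    using that by (induction J rule: finite_induct) auto
  thus ?thesis by (simp add: qpoch_def)
qed

lemma convergent_prod_fpsI:
  fixes f :: "nat \<Rightarrow> rat fps"
  assumes f: "\<And>n. \<exists>g. f n = 1 + fps_X ^ Suc n * g"
  shows "convergent_prod f"
proof -
  define P where "P = (\<lambda>n. \<Prod>i\<le>n. f i)"
  have step: "fps_nth (P (Suc n)) m = fps_nth (P n) m" if "m \<le> n" for n m
  proof -
    obtain g where g: "f (Suc n) = 1 + fps_X ^ Suc (Suc n) * g" using f by blast
    have "P (Suc n) = P n + fps_X ^ Suc (Suc n) * (P n * g)"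
      unfolding P_def prod.atMost_Suc g by (simp only: algebra_simps mult_1_left)
    thus ?thesis using that
      by (simp only: fps_add_nth fps_X_power_mult_nth) simp
  qed
  have stable: "fps_nth (P n) m = fps_nth (P m) m" if "m \<le> n" for n m
    using that by (induction rule: dec_induct) (simp_all add: step)
  have lim: "P \<longlonglongrightarrow> Abs_fps (\<lambda>m. fps_nth (P m) m)"
    by (rule tendsto_fpsI) (auto intro!: eventually_sequentiallyI stable)
  have "fps_nth (f 0) 0 = 1" using f[of 0] by auto
  hence "fps_nth (Abs_fps (\<lambda>m. fps_nth (P m) m)) 0 \<noteq> 0" by (simp add: P_def)
  hence "Abs_fps (\<lambda>m. fps_nth (P m) m) \<noteq> 0" by force
  thus ?thesis using lim
    by (auto simp: convergent_prod_def raw_has_prod_def P_def intro!: exI[of _ "0::nat"])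
qed

lemma convergent_qpoch_inf: "convergent_prod (\<lambda>j. 1 - fps_X ^ Suc j :: rat fps)"
  by (rule convergent_prod_fpsI) (auto intro: exI[of _ "-1"])


subsection \<open>Graph series\<close>

text \<open>A graph on the vertices \<open>1, \<dots>, r\<close> is given by its set of edges \<open>{i, j}\<close>.\<close>

definition simple_graph :: "nat \<Rightarrow> nat set set \<Rightarrow> bool" where
  "simple_graph r E \<longleftrightarrow> (\<forall>e\<in>E. e \<subseteq> {1..r} \<and> card e = 2)"

definition adj_matrix :: "nat set set \<Rightarrow> nat \<Rightarrow> nat \<Rightarrow> nat" where
  "adj_matrix E i j = (if {i, j} \<in> E then 1 else 0)"

text \<open>
  For a simple graph, the adjacency matrix is symmetric with zero diagonal, so
  the division by 2 in the exponent is exact.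
\<close>

definition graph_exponent :: "nat \<Rightarrow> nat set set \<Rightarrow> (nat \<Rightarrow> nat) \<Rightarrow> nat" where
  "graph_exponent r E n =
     (\<Sum>i=1..r. \<Sum>j=1..r. n i * adj_matrix E i j * n j) div 2 + (\<Sum>i=1..r. n i)"

text \<open>\<open>{1..r} \<rightarrow>\<^sub>E UNIV\<close> is the set of tuples \<open>(n\<^sub>1, \<dots>, n\<^sub>r)\<close> of natural numbers.\<close>

definition graph_series :: "nat \<Rightarrow> nat set set \<Rightarrow> rat fps" where
  "graph_series r E =
     (\<Sum>\<^sub>\<infinity>n \<in> {1..r} \<rightarrow>\<^sub>E UNIV.
        fps_X ^ graph_exponent r E n / (\<Prod>i=1..r. qpoch (n i)))"

lemma even_adj_form:
  assumes "simple_graph r E"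
  shows "even (\<Sum>i=1..r. \<Sum>j=1..r. n i * adj_matrix E i j * n j)"
proof -
  have diag: "adj_matrix E i i = 0" for i
    using assms by (force simp: adj_matrix_def simple_graph_def)
  have sym: "adj_matrix E i j = adj_matrix E j i" for i j
    by (simp add: adj_matrix_def insert_commute)
  have "even (\<Sum>i=1..s. \<Sum>j=1..s. n i * adj_matrix E i j * n j)" for s
  proof (induction s)
    case (Suc s)
    have "(\<Sum>i=1..Suc s. \<Sum>j=1..Suc s. n i * adj_matrix E i j * n j) =
          (\<Sum>i=1..s. \<Sum>j=1..s. n i * adj_matrix E i j * n j) +
          (\<Sum>i=1..s. n i * adj_matrix E i (Suc s) * n (Suc s)) +
          (\<Sum>j=1..s. n (Suc s) * adj_matrix E (Suc s) j * n j)"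
      by (simp add: sum.distrib diag)
    also have "(\<Sum>j=1..s. n (Suc s) * adj_matrix E (Suc s) j * n j) =
               (\<Sum>i=1..s. n i * adj_matrix E i (Suc s) * n (Suc s))"
      by (intro sum.cong refl) (simp add: sym[of "Suc s"] mult_ac)
    finally show ?case using Suc.IH by simp
  qed auto
  thus ?thesis .
qed

lemma summable_graph_series:
  "(\<lambda>n. fps_X ^ graph_exponent r E n / (\<Prod>i=1..r. qpoch (n i))) summable_on ({1..r} \<rightarrow>\<^sub>E UNIV)"
proof (rule summable_on_fpsI)
  fix m
  have "n \<in> {1..r} \<rightarrow>\<^sub>E {..m}"
    if n: "n \<in> {1..r} \<rightarrow>\<^sub>E UNIV"
      "fps_nth (fps_X ^ graph_exponent r E n / (\<Prod>i=1..r. qpoch (n i))) m \<noteq> 0" for n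
  proof -
    have "fps_nth (\<Prod>i\<in>I. qpoch (n i)) 0 = 1" if "finite I" for I
      using that by (induction I rule: finite_induct) (auto simp: qpoch_nth_0)
    hence "fps_nth (\<Prod>i=1..r. qpoch (n i)) 0 \<noteq> 0" by simp
    hence "graph_exponent r E n \<le> m" using fps_nth_X_power_div n(2) not_le by blast
    hence "n i \<le> m" if "i \<in> {1..r}" for i
      using member_le_sum[of i "{1..r}" n] that by (simp add: graph_exponent_def)
    thus ?thesis using n(1) by (auto simp: PiE_iff)
  qed
  hence "{n \<in> {1..r} \<rightarrow>\<^sub>E UNIV.
           fps_nth (fps_X ^ graph_exponent r E n / (\<Prod>i=1..r. qpoch (n i))) m \<noteq> 0}
         \<subseteq> {1..r} \<rightarrow>\<^sub>E {..m}" by blast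
  thus "finite {n \<in> {1..r} \<rightarrow>\<^sub>E UNIV.
          fps_nth (fps_X ^ graph_exponent r E n / (\<Prod>i=1..r. qpoch (n i))) m \<noteq> 0}"
    by (rule finite_subset) (auto intro: finite_PiE)
qed


subsection \<open>The two families of graphs\<close>

text \<open>The graph \<open>\<Gamma>\<close> on the vertices \<open>1, \<dots>, 3k+2\<close>.\<close>

definition Gamma_edges :: "nat \<Rightarrow> nat set set" where
  "Gamma_edges k =
     {{1, 2}, {2, 3}, {3, 4}, {4, 5}, {5, 1}}
     \<union> {{i, i + 1} | i. 5 \<le> i \<and> i \<le> 3 * k + 1}
     \<union> {{1, 3 * t + 2} | t. 2 \<le> t \<and> t \<le> k}
     \<union> {{4, 3 * t + 2} | t. 2 \<le> t \<and> t \<le> k}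
     \<union> {{3 * s + 1, 3 * (l + 1) + 2} | s l. 2 \<le> s \<and> s \<le> l \<and> l + 1 \<le> k}"

text \<open>The star-shaped tree \<open>T\<close> on the vertices \<open>1, \<dots>, 2k+2\<close>.\<close>

definition T_edges :: "nat \<Rightarrow> nat set set" where
  "T_edges k =
     {{1, 2 * j} | j. 1 \<le> j \<and> j \<le> k}
     \<union> {{2 * j, 2 * j + 1} | j. 1 \<le> j \<and> j \<le> k}
     \<union> {{1, 2 * k + 2}}"

lemma simple_graph_Gamma: "k \<ge> 1 \<Longrightarrow> simple_graph (3 * k + 2) (Gamma_edges k)"
  by (auto simp: simple_graph_def Gamma_edges_def card_insert_if)

lemma simple_graph_T: "simple_graph (2 * k + 2) (T_edges k)"
  by (auto simp: simple_graph_def T_edges_def card_insert_if)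


subsection \<open>The numerators\<close>

text \<open>The sums start at \<open>n = 1\<close>; for \<open>k \<ge> 1\<close> no subtraction is truncated.\<close>

definition Gamma_numerator :: "nat \<Rightarrow> rat fps" where
  "Gamma_numerator k =
     (\<Sum>\<^sub>\<infinity>n\<in>{1..}. of_nat (n * ((n + k - 2) choose (k - 1))) * fps_X ^ n / (1 - fps_X ^ n))"

text \<open>The product over \<open>n \<ge> 1\<close> is indexed by \<open>m = n - 1\<close>.\<close>

definition Gamma_product :: "nat \<Rightarrow> rat fps" where
  "Gamma_product k =
     (\<Prod>m. (1 - fps_X ^ Suc m) powi (- int ((Suc m + k - 2) choose (k - 1))))"

text \<open>Logarithmic derivative with respect to \<open>q d/dq\<close>.\<close>

definition q_log_deriv :: "rat fps \<Rightarrow> rat fps" where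
  "q_log_deriv f = fps_X * fps_deriv f / f"

definition zeta_q :: "nat \<Rightarrow> rat fps" where
  "zeta_q k = (\<Sum>\<^sub>\<infinity>n\<in>{1..}. fps_X ^ n / (1 - fps_X ^ n) ^ k)"

definition zeta_q_Lambert :: "nat \<Rightarrow> rat fps" where
  "zeta_q_Lambert k =
     (\<Sum>\<^sub>\<infinity>n\<in>{1..}. of_nat ((n + k - 2) choose (k - 1)) * fps_X ^ n / (1 - fps_X ^ n))"

lemma summable_X_power_div:
  fixes c :: "nat \<Rightarrow> nat" and g :: "nat \<Rightarrow> rat fps"
  assumes "\<And>n. n \<ge> 1 \<Longrightarrow> fps_nth (g n) 0 \<noteq> 0"
  shows "(\<lambda>n. of_nat (c n) * fps_X ^ n / g n) summable_on {1..}"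
proof (rule summable_on_fpsI)
  fix m
  have "fps_nth (of_nat (c n) * fps_X ^ n / g n) m = 0" if "n \<ge> 1" "m < n" for n
  proof -
    have "of_nat (c n) * fps_X ^ n / g n = of_nat (c n) * fps_X ^ n * inverse (g n)"
      by (rule fps_divide_unit) (use assms that in auto)
    also have "\<dots> = fps_X ^ n * (of_nat (c n) * inverse (g n))" by (simp add: mult_ac)
    finally show ?thesis using that by (simp add: fps_X_power_mult_nth)
  qed
  hence "{n \<in> {1..}. fps_nth (of_nat (c n) * fps_X ^ n / g n) m \<noteq> 0} \<subseteq> {..m}"
    by (force simp: not_less[symmetric])
  thus "finite {n \<in> {1..}. fps_nth (of_nat (c n) * fps_X ^ n / g n) m \<noteq> 0}"
    by (rule finite_subset) auto
qed

lemma summable_Gamma_numerator: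
  "(\<lambda>n. of_nat (n * ((n + k - 2) choose (k - 1))) * fps_X ^ n / (1 - fps_X ^ n) :: rat fps)
     summable_on {1..}"
  by (rule summable_X_power_div) auto

lemma summable_zeta_q:
  "(\<lambda>n. fps_X ^ n / (1 - fps_X ^ n) ^ k :: rat fps) summable_on {1..}"
proof -
  have "fps_nth ((1 - fps_X ^ n :: rat fps) ^ k) 0 \<noteq> 0" if "n \<ge> 1" for n
    using that by (cases n) (simp_all add: fps_nth_power_0)
  from summable_X_power_div[of "\<lambda>n. (1 - fps_X ^ n) ^ k" "\<lambda>_. 1", OF this] show ?thesis by simp
qed

lemma summable_zeta_q_Lambert:
  "(\<lambda>n. of_nat ((n + k - 2) choose (k - 1)) * fps_X ^ n / (1 - fps_X ^ n) :: rat fps)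
     summable_on {1..}"
  by (rule summable_X_power_div) auto

lemma convergent_Gamma_product:
  "convergent_prod (\<lambda>m. (1 - fps_X ^ Suc m :: rat fps) powi
     (- int ((Suc m + k - 2) choose (k - 1))))"
proof (rule convergent_prod_fpsI)
  fix m
  let ?x = "fps_X ^ Suc m :: rat fps"
  define c where "c = (Suc m + k - 2) choose (k - 1)"
  have inv: "inverse (1 - ?x) = 1 + ?x * inverse (1 - ?x)"
  proof -
    have "inverse (1 - ?x) * (1 - ?x) = 1" by (rule inverse_mult_eq_1) simp
    thus ?thesis by (simp add: algebra_simps)
  qed
  have "\<exists>g. inverse (1 - ?x) ^ c = 1 + ?x * g"
  proof (induction c)
    case (Suc c)
    then obtain g where g: "inverse (1 - ?x) ^ c = 1 + ?x * g" by blast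
    have "inverse (1 - ?x) ^ Suc c = (1 + ?x * inverse (1 - ?x)) * (1 + ?x * g)"
      using g inv by simp
    also have "\<dots> = 1 + ?x * (g + inverse (1 - ?x) * (1 + ?x * g))"
      by (simp add: algebra_simps)
    finally show ?case by blast
  qed (auto intro: exI[of _ 0])
  moreover have "(1 - ?x) powi (- int c) = inverse (1 - ?x) ^ c"
    by (cases "c = 0") (auto simp: power_int_def)
  ultimately show "\<exists>g. (1 - ?x) powi (- int ((Suc m + k - 2) choose (k - 1))) = 1 + ?x * g"
    by (simp add: c_def)
qed

end

theory Submission
  imports Defs
begin

text \<open>
  Both graphs are tripartite. Writing \<open>A\<close>, \<open>B\<close>, \<open>L\<close> for the three independent sets, the sums over
  the variables in \<open>L\<close> are instances of Euler's identity
  \<open>\<Sum>\<^sub>c q\<^bsup>c(N+1)\<^esup> / (q)\<^sub>c = (q)\<^sub>N / (q)\<^sub>\<infinity>\<close>, which leaves a product over \<open>B\<close> of the sums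
  \<open>\<Sum>\<^sub>b q\<^bsup>b(M+1)\<^esup> (q)\<^bsub>N+b\<^esub> / (q)\<^sub>b = (q)\<^sub>N (q)\<^sub>M / (q)\<^bsub>N+M+1\<^esub>\<close>. For the tree, \<open>A\<close> is the centre and the
  remaining single sum is \<open>\<zeta>\<^sub>q(k)\<close>. For \<open>\<Gamma>\<close>, where \<open>A\<close> consists of the vertices \<open>3t + 2\<close>, the
  products telescope, and expanding the factors \<open>1 / (1 - q\<^sup>j)\<close> turns the rest into
  \<open>\<Sum>\<^sub>m q\<^bsup>m-1\<^esup> / (1 - q\<^sup>m)\<^sup>2 h\<^bsub>k-1\<^esub>(m)\<close>, with \<open>h\<^sub>d(m)\<close> the complete homogeneous symmetric polynomial
  in \<open>1 / (1 - q\<^sup>i)\<close>, \<open>i \<le> m\<close>. The generating function of this sum in \<open>k\<close> is evaluated by a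
  two-parameter telescoping.
\<close>


subsection \<open>Coefficientwise finite families of power series\<close>

text \<open>Why the products for \<Gamma> telescope: write a_t for the variable at 3t + 2 and S_s =
  a_s + ... + a_k. Among the vertices 3t + 2, vertex 3s + 4 is joined exactly to those with t > s,
  and 3s + 3 is joined to 3s + 2 and 3s + 4. So the two parameters of the sum at 3s + 4 are a_s and
  S_(s+1), which add up to S_s. The final sum is treated for all degrees at once because the
  generating function of h_d(m) in x is (q)_m times the product of 1/(1 - x - q^j), 1 \<le> j \<le>
  m; replacing j by i + j supplies the second parameter. Telescoping trades the sum over m for the
  sum over i \<ge> 1 of q^i (1 - x)/(1 - x - q^i)^2, whose coefficients in x are differences of
  powers of 1/(1 - q^i). In degree d their binomial expansion has the coefficients (d+1)
  binom(j+d+1, d+1) - d binom(j+d, d) = (j+1) binom(j+d, d): this is the origin of the factor n in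
  the numerator.\<close>

text \<open>
  This is equivalent to \<open>q\<close>-adic summability; it is the form used below because \<open>fps\<close> is not an
  instance of \<^class>\<open>topological_comm_monoid_add\<close>, so the general lemmas on \<open>infsum\<close> do not apply.
\<close>

definition coeff_finite :: "('a \<Rightarrow> rat fps) \<Rightarrow> 'a set \<Rightarrow> bool" where
  "coeff_finite F A \<longleftrightarrow> (\<forall>m. finite {x\<in>A. fps_nth (F x) m \<noteq> 0})"

lemma coeff_finiteD: "coeff_finite F A \<Longrightarrow> finite {x\<in>A. fps_nth (F x) m \<noteq> 0}"
  by (simp add: coeff_finite_def)

lemma coeff_finite_cong:
  "A = B \<Longrightarrow> (\<And>x. x \<in> B \<Longrightarrow> F x = G x) \<Longrightarrow> coeff_finite F A \<longleftrightarrow> coeff_finite G B"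
  by (auto simp: coeff_finite_def cong: conj_cong)

lemma has_sum_coeff_finite:
  assumes "coeff_finite F A"
  shows "(F has_sum Abs_fps (\<lambda>m. \<Sum>x | x \<in> A \<and> fps_nth (F x) m \<noteq> 0. fps_nth (F x) m)) A"
  by (rule has_sum_fpsI) (use assms in \<open>auto simp: coeff_finite_def\<close>)

lemma infsum_fps_nth:
  assumes "coeff_finite F A"
  shows "fps_nth (infsum F A) m = (\<Sum>x | x \<in> A \<and> fps_nth (F x) m \<noteq> 0. fps_nth (F x) m)"
  using infsumI[OF has_sum_coeff_finite[OF assms]] by simp

text \<open>The working form of a coefficient: any finite index set outside of which coefficient m
  vanishes will do, so several sums can be compared over one common set.\<close>

lemma infsum_fps_nth_superset:
  assumes "coeff_finite F A" "finite B" "B \<subseteq> A" "\<And>x. x \<in> A - B \<Longrightarrow> fps_nth (F x) m = 0"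
  shows "fps_nth (infsum F A) m = (\<Sum>x\<in>B. fps_nth (F x) m)"
  unfolding infsum_fps_nth[OF assms(1)]
  by (rule sum.mono_neutral_left) (use assms in auto)

lemma coeff_finite_mono: "coeff_finite F A \<Longrightarrow> B \<subseteq> A \<Longrightarrow> coeff_finite F B"
  unfolding coeff_finite_def by (intro allI, erule allE, erule finite_subset[rotated]) auto

lemma coeff_finite_cmult:
  assumes "coeff_finite F A"
  shows "coeff_finite (\<lambda>x. c * F x) A"
  unfolding coeff_finite_def
proof
  fix m
  have "{x \<in> A. fps_nth (c * F x) m \<noteq> 0} \<subseteq> (\<Union>i\<le>m. {x\<in>A. fps_nth (F x) i \<noteq> 0})"
    by (auto simp: fps_mult_nth elim!: sum.not_neutral_contains_not_neutral
          intro!: bexI[of _ "m - _"])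
  thus "finite {x \<in> A. fps_nth (c * F x) m \<noteq> 0}"
    by (rule finite_subset) (use assms in \<open>auto simp: coeff_finite_def\<close>)
qed

lemma infsum_fps_cmult:
  assumes "coeff_finite F A"
  shows "infsum (\<lambda>x. c * F x) A = c * infsum F A"
proof (rule fps_ext)
  fix m
  \<comment> \<open>Coefficient m of a product involves all coefficients of \<open>F x\<close> up to
    m, so \<open>B\<close> collects the supports for every i \<le> m.\<close>
  define B where "B = (\<Union>i\<le>m. {x\<in>A. fps_nth (F x) i \<noteq> 0})"
  have B: "finite B" "B \<subseteq> A" using assms by (auto simp: B_def coeff_finite_def)
  have z: "fps_nth (F x) i = 0" if "x \<in> A - B" "i \<le> m" for x i
    using that by (auto simp: B_def)
  have "fps_nth (infsum (\<lambda>x. c * F x) A) m = (\<Sum>x\<in>B. fps_nth (c * F x) m)"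
    by (rule infsum_fps_nth_superset[OF coeff_finite_cmult[OF assms] B])
       (auto simp: fps_mult_nth z)
  also have "\<dots> = (\<Sum>i=0..m. fps_nth c i * (\<Sum>x\<in>B. fps_nth (F x) (m - i)))"
    unfolding fps_mult_nth by (subst sum.swap) (simp add: sum_distrib_left)
  also have "\<dots> = (\<Sum>i=0..m. fps_nth c i * fps_nth (infsum F A) (m - i))"
    by (intro sum.cong refl arg_cong[where f = "\<lambda>x. _ * x"]
          infsum_fps_nth_superset[OF assms B, symmetric] z) auto
  finally show "fps_nth (infsum (\<lambda>x. c * F x) A) m = fps_nth (c * infsum F A) m"
    by (simp add: fps_mult_nth)
qed

lemma infsum_fps_multc:
  "coeff_finite F A \<Longrightarrow> infsum (\<lambda>x. F x * c) A = infsum F A * c"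
  using infsum_fps_cmult[of F A c] by (simp add: mult.commute)

lemma coeff_finite_add:
  assumes "coeff_finite F A" "coeff_finite G A"
  shows "coeff_finite (\<lambda>x. F x + G x) A"
  unfolding coeff_finite_def
proof
  fix m
  have "{x \<in> A. fps_nth (F x + G x) m \<noteq> 0}
      \<subseteq> {x \<in> A. fps_nth (F x) m \<noteq> 0} \<union> {x \<in> A. fps_nth (G x) m \<noteq> 0}"
    by auto
  thus "finite {x \<in> A. fps_nth (F x + G x) m \<noteq> 0}"
    by (rule finite_subset) (use assms in \<open>auto simp: coeff_finite_def\<close>)
qed

lemma infsum_fps_add:
  assumes "coeff_finite F A" "coeff_finite G A"
  shows "infsum (\<lambda>x. F x + G x) A = infsum F A + infsum G A"
proof (rule fps_ext)
  fix m
  define B where "B = {x\<in>A. fps_nth (F x) m \<noteq> 0} \<union> {x\<in>A. fps_nth (G x) m \<noteq> 0}"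
  have B: "finite B" "B \<subseteq> A" using assms by (auto simp: B_def coeff_finite_def)
  have z: "fps_nth (F x) m = 0" "fps_nth (G x) m = 0" if "x \<in> A - B" for x
    using that by (auto simp: B_def)
  have "fps_nth (infsum F A) m = (\<Sum>x\<in>B. fps_nth (F x) m)"
       "fps_nth (infsum G A) m = (\<Sum>x\<in>B. fps_nth (G x) m)"
       "fps_nth (infsum (\<lambda>x. F x + G x) A) m = (\<Sum>x\<in>B. fps_nth (F x + G x) m)"
    by (rule infsum_fps_nth_superset; use assms B z coeff_finite_add[OF assms] in simp)+
  thus "fps_nth (infsum (\<lambda>x. F x + G x) A) m = fps_nth (infsum F A + infsum G A) m"
    by (simp add: sum.distrib)
qed

lemma infsum_fps_diff:
  assumes "coeff_finite F A" "coeff_finite G A"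
  shows "infsum (\<lambda>x. F x - G x) A = infsum F A - infsum G A"
  using infsum_fps_add[OF assms(1) coeff_finite_cmult[OF assms(2), of "-1"]]
    infsum_fps_cmult[OF assms(2), of "-1"] by simp

lemma coeff_finite_reindex:
  assumes "bij_betw h A B"
  shows "coeff_finite (\<lambda>x. F (h x)) A \<longleftrightarrow> coeff_finite F B"
proof -
  have "{x\<in>B. fps_nth (F x) m \<noteq> 0} = h ` {x\<in>A. fps_nth (F (h x)) m \<noteq> 0}" for m
    using assms by (auto simp: bij_betw_def)
  moreover have "inj_on h {x\<in>A. fps_nth (F (h x)) m \<noteq> 0}" for m
    using assms by (auto simp: bij_betw_def intro: inj_on_subset)
  ultimately show ?thesis by (simp add: coeff_finite_def finite_image_iff)
qed

text \<open>The summability criterion behind most sums below: \<open>G x\<close> is arbitrary, so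
  only the sublevel sets of the exponent matter.\<close>

lemma coeff_finite_X_power:
  assumes "\<And>m. finite {x\<in>A. e x \<le> m}"
  shows "coeff_finite (\<lambda>x. fps_X ^ e x * G x) A"
  unfolding coeff_finite_def
proof
  fix m
  have "{x\<in>A. fps_nth (fps_X ^ e x * G x) m \<noteq> 0} \<subseteq> {x\<in>A. e x \<le> m}"
    by (auto simp: fps_X_power_mult_nth split: if_splits)
  thus "finite {x\<in>A. fps_nth (fps_X ^ e x * G x) m \<noteq> 0}"
    using assms finite_subset by blast
qed

section \<open>Double sums and interchange of summation\<close>

text \<open>Only finitely many pairs contribute to coefficient m, and the two projections of this
  finite set \<open>S m\<close> bound all the iterated sums. Fubini thus reduces to a finite
  rectangle, in which pairs outside \<open>S m\<close> contribute zero.\<close>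

lemma
  assumes "coeff_finite (\<lambda>(x, y). F x y) (A \<times> B)"
  shows coeff_finite_inner: "x \<in> A \<Longrightarrow> coeff_finite (F x) B"
    and coeff_finite_outer: "coeff_finite (\<lambda>x. infsum (F x) B) A"
    and infsum_fps_Times:
      "infsum (\<lambda>(x, y). F x y) (A \<times> B) = infsum (\<lambda>x. infsum (F x) B) A"
proof -
  have inner: "coeff_finite (F x) B" if "x \<in> A" for x
    unfolding coeff_finite_def
  proof
    fix m
    have "finite (snd ` {p \<in> A \<times> B. fps_nth (case p of (x, y) \<Rightarrow> F x y) m \<noteq> 0})"
      using assms by (auto simp: coeff_finite_def)
    moreover have "{y \<in> B. fps_nth (F x y) m \<noteq> 0}
        \<subseteq> snd ` {p \<in> A \<times> B. fps_nth (case p of (x, y) \<Rightarrow> F x y) m \<noteq> 0}"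
      using that by force
    ultimately show "finite {y \<in> B. fps_nth (F x y) m \<noteq> 0}" using finite_subset by blast
  qed
  thus "x \<in> A \<Longrightarrow> coeff_finite (F x) B" .
  define S where "S m = {p \<in> A \<times> B. fps_nth (case p of (x, y) \<Rightarrow> F x y) m \<noteq> 0}" for m
  have finS: "finite (S m)" for m using assms by (auto simp: coeff_finite_def S_def)
  have nth: "fps_nth (infsum (F x) B) m = (\<Sum>y\<in>snd ` S m. fps_nth (F x y) m)" if "x \<in> A" for x m
    by (rule infsum_fps_nth_superset[OF inner[OF that]])
       (use that finS in \<open>auto simp: S_def image_iff\<close>)
  have zero: "fps_nth (infsum (F x) B) m = 0" if "x \<in> A" "x \<notin> fst ` S m" for x m
    unfolding nth[OF that(1)]
    by (rule sum.neutral) (use that in \<open>force simp: S_def image_iff\<close>)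
  show outer: "coeff_finite (\<lambda>x. infsum (F x) B) A"
    unfolding coeff_finite_def
  proof
    fix m
    have "{x \<in> A. fps_nth (infsum (F x) B) m \<noteq> 0} \<subseteq> fst ` S m" using zero by blast
    thus "finite {x \<in> A. fps_nth (infsum (F x) B) m \<noteq> 0}"
      using finS finite_subset by blast
  qed
  show "infsum (\<lambda>(x, y). F x y) (A \<times> B) = infsum (\<lambda>x. infsum (F x) B) A"
  proof (rule fps_ext)
    fix m
    have "fps_nth (infsum (\<lambda>x. infsum (F x) B) A) m
        = (\<Sum>x\<in>fst ` S m. fps_nth (infsum (F x) B) m)"
      by (rule infsum_fps_nth_superset[OF outer])
         (use zero finS in \<open>auto simp: S_def\<close>)
    also have "\<dots> = (\<Sum>x\<in>fst ` S m. \<Sum>y\<in>snd ` S m. fps_nth (F x y) m)"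
      by (intro sum.cong refl nth) (auto simp: S_def)
    also have "\<dots> = (\<Sum>(x, y)\<in>fst ` S m \<times> snd ` S m. fps_nth (F x y) m)"
      by (rule sum.cartesian_product)
    also have "\<dots> = (\<Sum>(x, y)\<in>S m. fps_nth (F x y) m)"
      by (rule sum.mono_neutral_right)
         (use finS in \<open>auto simp: S_def split: prod.splits, (force simp: image_iff)+\<close>)
    also have "\<dots> = fps_nth (infsum (\<lambda>(x, y). F x y) (A \<times> B)) m"
      unfolding infsum_fps_nth[OF assms] S_def by (simp add: case_prod_beta)
    finally show "fps_nth (infsum (\<lambda>(x, y). F x y) (A \<times> B)) m
        = fps_nth (infsum (\<lambda>x. infsum (F x) B) A) m" ..
  qed
qed

lemma coeff_finite_swap:
  "coeff_finite (\<lambda>(x, y). F x y) (A \<times> B) \<longleftrightarrow> coeff_finite (\<lambda>(y, x). F x y) (B \<times> A)"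
proof -
  have "bij_betw prod.swap (A \<times> B) (B \<times> A)"
    by (auto simp: bij_betw_def)
  from coeff_finite_reindex[OF this, of "\<lambda>(y, x). F x y"] show ?thesis
    by (simp add: case_prod_unfold)
qed

lemma infsum_fps_swap:
  assumes "coeff_finite (\<lambda>(x, y). F x y) (A \<times> B)"
  shows "infsum (\<lambda>x. infsum (F x) B) A = infsum (\<lambda>y. infsum (\<lambda>x. F x y) A) B"
proof -
  have "bij_betw prod.swap (A \<times> B) (B \<times> A)"
    by (auto simp: bij_betw_def)
  from infsum_reindex_bij_betw[OF this, of "\<lambda>(y, x). F x y"]
  have "infsum (\<lambda>(x, y). F x y) (A \<times> B) = infsum (\<lambda>(y, x). F x y) (B \<times> A)"
    by (simp add: case_prod_unfold)
  thus ?thesis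
    using infsum_fps_Times[OF assms] infsum_fps_Times[OF iffD1[OF coeff_finite_swap assms]]
    by simp
qed

lemma coeff_finite_Times:
  assumes "coeff_finite F A" "coeff_finite G B"
  shows "coeff_finite (\<lambda>(x, y). F x * G y) (A \<times> B)"
  unfolding coeff_finite_def
proof
  fix m
  have "{p \<in> A \<times> B. fps_nth (case p of (x, y) \<Rightarrow> F x * G y) m \<noteq> 0}
      \<subseteq> (\<Union>i\<le>m. {x\<in>A. fps_nth (F x) i \<noteq> 0}) \<times> (\<Union>i\<le>m. {y\<in>B. fps_nth (G y) i \<noteq> 0})"
  proof (intro subsetI, elim CollectE conjE SigmaE, hypsubst, unfold prod.case)
    fix x y
    assume xy: "x \<in> A" "y \<in> B" "fps_nth (F x * G y) m \<noteq> 0"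
    then obtain i where "i \<in> {0..m}" "fps_nth (F x) i * fps_nth (G y) (m - i) \<noteq> 0"
      unfolding fps_mult_nth by (meson sum.neutral)
    thus "(x, y) \<in> (\<Union>i\<le>m. {x\<in>A. fps_nth (F x) i \<noteq> 0}) \<times> (\<Union>i\<le>m. {y\<in>B. fps_nth (G y) i \<noteq> 0})"
      using xy by (auto intro: bexI[of _ i] bexI[of _ "m - i"])
  qed
  thus "finite {p \<in> A \<times> B. fps_nth (case p of (x, y) \<Rightarrow> F x * G y) m \<noteq> 0}"
    by (rule finite_subset) (use assms in \<open>auto simp: coeff_finite_def\<close>)
qed

section \<open>Sums over tuples\<close>

text \<open>Distributivity of a finite product over infinite sums, by induction on \<open>I\<close>:
  a tuple is split as \<open>g(i := y)\<close>, and the double sum separates y from g.\<close>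

lemma coeff_finite_prod_PiE:
  assumes "finite I" "\<And>i. i \<in> I \<Longrightarrow> coeff_finite (F i) B"
  shows "coeff_finite (\<lambda>f. \<Prod>i\<in>I. F i (f i)) (I \<rightarrow>\<^sub>E B)"
    and "infsum (\<lambda>f. \<Prod>i\<in>I. F i (f i)) (I \<rightarrow>\<^sub>E B) = (\<Prod>i\<in>I. infsum (F i) B)"
proof -
  have "coeff_finite (\<lambda>f. \<Prod>i\<in>I. F i (f i)) (I \<rightarrow>\<^sub>E B) \<and>
        infsum (\<lambda>f. \<Prod>i\<in>I. F i (f i)) (I \<rightarrow>\<^sub>E B) = (\<Prod>i\<in>I. infsum (F i) B)"
    using assms
  proof (induction I rule: finite_induct)
    case empty
    thus ?case by (simp add: coeff_finite_def)
  next
    case (insert i I)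
    let ?h = "\<lambda>(y, g). g(i := y)"
    let ?P = "\<lambda>f. \<Prod>j\<in>insert i I. F j (f j)"
    have bij: "bij_betw ?h (B \<times> (I \<rightarrow>\<^sub>E B)) (insert i I \<rightarrow>\<^sub>E B)"
      using inj_combinator[OF insert(2), of "\<lambda>_. B"] by (simp add: bij_betw_def PiE_insert_eq)
    have eq: "?P (?h p) = (case p of (y, g) \<Rightarrow> F i y * (\<Prod>j\<in>I. F j (g j)))" for p
      using insert(1,2) by (auto intro!: prod.cong split: prod.splits)
    have fin: "coeff_finite (\<lambda>(y, g). F i y * (\<Prod>j\<in>I. F j (g j))) (B \<times> (I \<rightarrow>\<^sub>E B))"
      by (rule coeff_finite_Times) (use insert in auto)
    have "coeff_finite ?P (insert i I \<rightarrow>\<^sub>E B)"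
      by (subst coeff_finite_reindex[OF bij, symmetric]) (simp only: eq fin)
    moreover have "infsum ?P (insert i I \<rightarrow>\<^sub>E B)
        = infsum (\<lambda>(y, g). F i y * (\<Prod>j\<in>I. F j (g j))) (B \<times> (I \<rightarrow>\<^sub>E B))"
      by (subst infsum_reindex_bij_betw[OF bij, symmetric]) (simp only: eq)
    moreover have "\<dots> = infsum (F i) B * (\<Prod>j\<in>I. infsum (F j) B)"
      using insert by (simp add: infsum_fps_Times[OF fin] infsum_fps_cmult infsum_fps_multc)
    ultimately show ?case using insert by simp
  qed
  thus "coeff_finite (\<lambda>f. \<Prod>i\<in>I. F i (f i)) (I \<rightarrow>\<^sub>E B)"
    and "infsum (\<lambda>f. \<Prod>i\<in>I. F i (f i)) (I \<rightarrow>\<^sub>E B) = (\<Prod>i\<in>I. infsum (F i) B)" by auto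
qed

lemma finite_PiE_sum_le:
  assumes "finite I"
  shows "finite {f \<in> I \<rightarrow>\<^sub>E (UNIV :: nat set). (\<Sum>i\<in>I. f i) \<le> m}"
proof (rule finite_subset)
  have "f i \<le> m" if "(\<Sum>i\<in>I. f i) \<le> m" "i \<in> I" for f :: "'a \<Rightarrow> nat" and i
    using member_le_sum[of i I f] that assms by simp
  thus "{f \<in> I \<rightarrow>\<^sub>E (UNIV :: nat set). (\<Sum>i\<in>I. f i) \<le> m} \<subseteq> I \<rightarrow>\<^sub>E {..m}"
    by (auto simp: PiE_iff extensional_def)
qed (use assms in \<open>auto intro: finite_PiE\<close>)

lemma bij_betw_PiE_Un:
  assumes "I \<inter> J = {}"
  shows "bij_betw (\<lambda>(f, g) i. if i \<in> I then f i else g i)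
           ((I \<rightarrow>\<^sub>E B) \<times> (J \<rightarrow>\<^sub>E B)) (I \<union> J \<rightarrow>\<^sub>E B)"
proof (rule bij_betw_byWitness[where f' = "\<lambda>f. (restrict f I, restrict f J)"])
  show "\<forall>p\<in>(I \<rightarrow>\<^sub>E B) \<times> (J \<rightarrow>\<^sub>E B).
      (\<lambda>f. (restrict f I, restrict f J)) (case p of (f, g) \<Rightarrow> \<lambda>i. if i \<in> I then f i else g i) = p"
  proof (intro ballI, elim SigmaE, hypsubst, unfold prod.case)
    fix f g assume fg: "f \<in> I \<rightarrow>\<^sub>E B" "g \<in> J \<rightarrow>\<^sub>E B"
    have "restrict (\<lambda>i. if i \<in> I then f i else g i) I = f"
      using fg by (auto simp: restrict_def intro!: ext dest: PiE_arb)
    moreover have "restrict (\<lambda>i. if i \<in> I then f i else g i) J = g"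
      using fg assms by (intro ext) (auto simp: restrict_def dest: PiE_arb)
    ultimately show "(restrict (\<lambda>i. if i \<in> I then f i else g i) I,
        restrict (\<lambda>i. if i \<in> I then f i else g i) J) = (f, g)" by simp
  qed
  show "\<forall>f\<in>I \<union> J \<rightarrow>\<^sub>E B.
      (case (restrict f I, restrict f J) of (f, g) \<Rightarrow> \<lambda>i. if i \<in> I then f i else g i) = f"
    by (auto simp: PiE_iff extensional_def restrict_def fun_eq_iff)
qed (auto simp: PiE_iff extensional_def)


subsection \<open>Sums over a single index\<close>

text \<open>Splitting off the first term is how the geometric, Euler and negative binomial series
  obtain their functional equations.\<close>

lemma infsum_fps_Suc:
  assumes "coeff_finite F UNIV"
  shows "infsum F UNIV = F 0 + infsum (\<lambda>n. F (Suc n)) UNIV"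
proof (rule fps_ext)
  fix m
  have S: "coeff_finite (\<lambda>n. F (Suc n)) UNIV"
    using coeff_finite_reindex[of Suc UNIV "range Suc" F] coeff_finite_mono[OF assms]
    by (auto simp: bij_betw_def)
  obtain N where N: "{n. fps_nth (F n) m \<noteq> 0} \<subseteq> {..N}"
    using coeff_finiteD[OF assms, of m] finite_nat_set_iff_bounded_le by auto
  have "fps_nth (infsum F UNIV) m = (\<Sum>n\<le>Suc N. fps_nth (F n) m)"
    by (rule infsum_fps_nth_superset[OF assms]) (use N in force)+
  moreover have "fps_nth (infsum (\<lambda>n. F (Suc n)) UNIV) m = (\<Sum>n\<le>N. fps_nth (F (Suc n)) m)"
    by (rule infsum_fps_nth_superset[OF S]) (use N in force)+
  ultimately show "fps_nth (infsum F UNIV) m = fps_nth (F 0 + infsum (\<lambda>n. F (Suc n)) UNIV) m"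
    by (simp only: sum.atMost_Suc_shift fps_add_nth)
qed

lemma coeff_finite_power_nat:
  assumes "0 < n"
  shows "coeff_finite (\<lambda>j. fps_X ^ (j * n) * G j) UNIV"
proof (rule coeff_finite_X_power)
  fix m
  have "{j \<in> UNIV. j * n \<le> m} \<subseteq> {..m}"
    using assms by (auto intro: order_trans[rotated])
  thus "finite {j \<in> UNIV. j * n \<le> m}" by (rule finite_subset) auto
qed

text \<open>\<open>qgeom 0\<close> is only a default value, since 1 - q^0 = 0; hence the hypotheses
  \<open>0 < n\<close> and the many indices \<open>Suc n\<close>.\<close>

definition qgeom :: "nat \<Rightarrow> rat fps" where
  "qgeom n = inverse (1 - fps_X ^ n)"

lemma qgeom_mult: "0 < n \<Longrightarrow> (1 - fps_X ^ n) * qgeom n = 1"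
  unfolding qgeom_def by (subst mult.commute, rule inverse_mult_eq_1) simp

lemma qgeom_eqI: "0 < n \<Longrightarrow> (1 - fps_X ^ n) * f = 1 \<Longrightarrow> f = qgeom n"
  by (metis mult.assoc mult.commute mult_1 qgeom_mult)

lemma infsum_geometric: "0 < n \<Longrightarrow> infsum (\<lambda>j. fps_X ^ (j * n)) UNIV = qgeom n"
proof -
  assume n: "0 < n"
  have fin: "coeff_finite (\<lambda>j. fps_X ^ (j * n)) UNIV"
    using coeff_finite_power_nat[OF n, of "\<lambda>_. 1"] by simp
  have "infsum (\<lambda>j. fps_X ^ (j * n)) UNIV
      = (1 :: rat fps) + infsum (\<lambda>j. fps_X ^ n * fps_X ^ (j * n)) UNIV"
    by (subst infsum_fps_Suc[OF fin]) (simp add: power_add)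
  also have "infsum (\<lambda>j. fps_X ^ n * fps_X ^ (j * n)) UNIV
      = fps_X ^ n * (infsum (\<lambda>j. fps_X ^ (j * n)) UNIV :: rat fps)"
    by (rule infsum_fps_cmult[OF fin])
  finally show "infsum (\<lambda>j. fps_X ^ (j * n)) UNIV = qgeom n"
    by (intro qgeom_eqI[OF n]) (simp add: algebra_simps)
qed

section \<open>Pochhammer symbols and their limit\<close>

lemma qpoch_0 [simp]: "qpoch 0 = 1"
  by (simp add: qpoch_def)

lemma qpoch_Suc: "qpoch (Suc n) = qpoch n * (1 - fps_X ^ Suc n)"
  by (simp add: qpoch_def)

lemma qpoch_inverse: "qpoch n * inverse (qpoch n) = 1"
  by (subst mult.commute, rule inverse_mult_eq_1) (simp add: qpoch_nth_0)

lemma inverse_qpoch_Suc: "inverse (qpoch (Suc n)) = inverse (qpoch n) * qgeom (Suc n)"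
  by (simp only: qpoch_Suc fps_inverse_mult qgeom_def)

text \<open>Factor i is 1 modulo q^(i+1), so factors with index above m leave coefficient m
  unchanged and the partial products stabilise coefficientwise.\<close>

lemma prodinf_fps_nth:
  fixes f :: "nat \<Rightarrow> rat fps"
  assumes f: "\<And>n. \<exists>g. f n = 1 + fps_X ^ Suc n * g" and "m \<le> n"
  shows "fps_nth (prodinf f) m = fps_nth (\<Prod>i\<le>n. f i) m"
proof -
  define P where "P = (\<lambda>n. \<Prod>i\<le>n. f i)"
  have step: "fps_nth (P (Suc n)) m = fps_nth (P n) m" if "m \<le> n" for n m
  proof -
    obtain g where g: "f (Suc n) = 1 + fps_X ^ Suc (Suc n) * g" using f by blast
    have "P (Suc n) = P n + fps_X ^ Suc (Suc n) * (P n * g)"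
      unfolding P_def prod.atMost_Suc g by (simp only: algebra_simps mult_1_left)
    thus ?thesis using that
      by (simp only: fps_add_nth fps_X_power_mult_nth) simp
  qed
  have stable: "fps_nth (P n) m = fps_nth (P m) m" if "m \<le> n" for n m
    using that by (induction rule: dec_induct) (simp_all add: step)
  have lim: "P \<longlonglongrightarrow> Abs_fps (\<lambda>m. fps_nth (P m) m)"
    by (rule tendsto_fpsI) (auto intro!: eventually_sequentiallyI stable)
  \<comment> \<open>\<open>raw_has_prod\<close> demands a nonzero limit; its constant coefficient is
    1.\<close>
  have "fps_nth (f 0) 0 = 1" using f[of 0] by auto
  hence "fps_nth (Abs_fps (\<lambda>m. fps_nth (P m) m)) 0 \<noteq> 0" by (simp add: P_def)
  hence "Abs_fps (\<lambda>m. fps_nth (P m) m) \<noteq> 0" by force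
  with lim have "f has_prod Abs_fps (\<lambda>m. fps_nth (P m) m)"
    by (simp add: has_prod_def raw_has_prod_def P_def)
  from has_prod_unique[OF this] show ?thesis
    using stable[OF assms(2)] by (metis P_def fps_nth_Abs_fps)
qed

lemma qpoch_inf_nth:
  assumes "m \<le> n"
  shows "fps_nth qpoch_inf m = fps_nth (qpoch n) m"
proof -
  have "fps_nth qpoch_inf m = fps_nth (\<Prod>i\<le>n. 1 - fps_X ^ Suc i) m"
    unfolding qpoch_inf_def by (rule prodinf_fps_nth[OF _ assms]) (auto intro: exI[of _ "-1"])
  \<comment> \<open>This partial product has n + 1 factors; the surplus factor 1 - q^(n+1) does not
    affect coefficients up to n.\<close>
  also have "(\<Prod>i\<le>n. 1 - fps_X ^ Suc i) = qpoch (Suc n)"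
    by (induction n) (simp_all add: qpoch_Suc del: power_Suc)
  also have "fps_nth (qpoch (Suc n)) m = fps_nth (qpoch n) m"
    using assms by (simp add: qpoch_Suc algebra_simps fps_X_power_mult_right_nth del: power_Suc)
  finally show ?thesis .
qed

lemma qpoch_inf_nth_0: "fps_nth qpoch_inf 0 = 1"
  using qpoch_inf_nth[of 0 0] by simp

lemma qpoch_inf_inverse: "qpoch_inf * inverse qpoch_inf = 1"
  by (subst mult.commute, rule inverse_mult_eq_1) (simp add: qpoch_inf_nth_0)

section \<open>Euler's identity and a q-beta sum\<close>

text \<open>Writing E_N for the left side, the factor 1 - q^c in E_N - E_(N+1) cancels the last
  factor of (q)_c and gives E_(N+1) = (1 - q^(N+1)) E_N. Hence E_N = (q)_N E_0, and E_0 is found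
  from the fact that E_N tends to 1.\<close>

lemma infsum_Euler:
  "infsum (\<lambda>c. fps_X ^ (c * Suc N) * inverse (qpoch c)) UNIV = qpoch N * inverse qpoch_inf"
proof -
  define E where "E N = infsum (\<lambda>c. fps_X ^ (c * Suc N) * inverse (qpoch c)) UNIV" for N
  have fin: "coeff_finite (\<lambda>c. fps_X ^ (c * Suc N) * G c) UNIV" for N G
    by (rule coeff_finite_power_nat) simp
  have step: "E (Suc N) = (1 - fps_X ^ Suc N) * E N" for N
  proof -
    have "E N - E (Suc N)
        = infsum (\<lambda>c. fps_X ^ (c * Suc N) * ((1 - fps_X ^ c) * inverse (qpoch c))) UNIV"
      unfolding E_def
      by (subst infsum_fps_diff[OF fin fin, symmetric])
         (simp add: algebra_simps power_add)
    also have "\<dots> = infsum (\<lambda>c. fps_X ^ Suc N * (fps_X ^ (c * Suc N) * inverse (qpoch c))) UNIV"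
    proof (subst infsum_fps_Suc[OF fin], unfold mult_zero_left power_0 diff_self mult_zero_right add_0_left,
        rule infsum_cong)
      fix c
      have "(1 - fps_X ^ Suc c) * inverse (qpoch (Suc c)) = inverse (qpoch c)"
        using qgeom_mult[of "Suc c"] by (simp add: inverse_qpoch_Suc mult.left_commute del: power_Suc)
      thus "fps_X ^ (Suc c * Suc N) * ((1 - fps_X ^ Suc c) * inverse (qpoch (Suc c)))
          = fps_X ^ Suc N * (fps_X ^ (c * Suc N) * inverse (qpoch c))"
        by (simp add: power_add mult_ac)
    qed
    also have "\<dots> = fps_X ^ Suc N * E N"
      unfolding E_def by (rule infsum_fps_cmult[OF fin])
    finally show ?thesis by (simp add: algebra_simps)
  qed
  have E: "E N = qpoch N * E 0" for N
    by (induction N) (simp_all add: step qpoch_Suc mult_ac del: power_Suc)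
  \<comment> \<open>Up to degree m, (q)_\<infinity> and (q)_m agree, and (q)_m E_0 = E_m. In
    coefficient m of E_m only c = 0 contributes, because m < c (m + 1) for c > 0.\<close>
  have "fps_nth (qpoch_inf * E 0) m = fps_nth 1 m" for m
  proof -
    have "fps_nth (qpoch_inf * E 0) m = fps_nth (qpoch m * E 0) m"
      unfolding fps_mult_nth by (intro sum.cong refl) (simp add: qpoch_inf_nth[of _ m])
    also have "\<dots> = fps_nth (E m) m" by (simp add: E[of m])
    also have "\<dots> = (\<Sum>c\<in>{0}. fps_nth (fps_X ^ (c * Suc m) * inverse (qpoch c)) m)"
      unfolding E_def by (rule infsum_fps_nth_superset[OF fin])
         (auto simp: fps_X_power_mult_nth gr0_conv_Suc)
    finally show ?thesis by simp
  qed
  hence "qpoch_inf * E 0 = 1" by (rule fps_ext)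
  hence "E 0 = inverse qpoch_inf"
    using qpoch_inf_inverse by (metis fps_inverse_unique)
  thus ?thesis using E[of N] unfolding E_def by (simp only:)
qed

text \<open>A q-analogue of the beta integral with value N! M! / (N + M + 1)!. The last factor of
  (q)_(N+1+b) gives B(M, N+1) = B(M, N) - q^(N+1) B(M+1, N) for the left side B(M, N), so the
  induction on N must leave M free.\<close>

lemma infsum_qbeta:
  "infsum (\<lambda>b. fps_X ^ (b * Suc M) * (qpoch (N + b) * inverse (qpoch b))) UNIV
     = qpoch N * qpoch M * inverse (qpoch (Suc (N + M)))"
proof (induction N arbitrary: M)
  case 0
  show ?case
    by (simp add: qpoch_inverse infsum_geometric inverse_qpoch_Suc mult.assoc[symmetric] del: power_Suc mult_Suc_right)
next
  case (Suc N)
  have fin: "coeff_finite (\<lambda>c. fps_X ^ (c * Suc M) * G c) UNIV" for M G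
    by (rule coeff_finite_power_nat) simp
  define B where "B M N = infsum (\<lambda>b. fps_X ^ (b * Suc M) * (qpoch (N + b) * inverse (qpoch b))) UNIV" for M N
  have "B M (Suc N) = infsum (\<lambda>b. fps_X ^ (b * Suc M) * (qpoch (N + b) * inverse (qpoch b))
      - fps_X ^ Suc N * (fps_X ^ (b * Suc (Suc M)) * (qpoch (N + b) * inverse (qpoch b)))) UNIV"
    unfolding B_def
    by (rule infsum_cong) (simp add: qpoch_Suc algebra_simps power_add)
  also have "\<dots> = B M N - fps_X ^ Suc N * B (Suc M) N"
    unfolding B_def by (simp only: infsum_fps_diff infsum_fps_cmult fin coeff_finite_cmult)
  also have "\<dots> = qpoch N * qpoch M * inverse (qpoch (Suc (N + M)))
      - fps_X ^ Suc N * (qpoch N * qpoch (Suc M) * inverse (qpoch (Suc (N + Suc M))))"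
    by (simp only: B_def Suc.IH)
  \<comment> \<open>Over the common denominator (q)_(N+M+2) the two terms combine by (1 - q^(N+M+2))
    - q^(N+1) (1 - q^(M+1)) = 1 - q^(N+1).\<close>
  also have "inverse (qpoch (Suc (N + M))) =
      (1 - fps_X ^ Suc (Suc (N + M))) * inverse (qpoch (Suc (N + Suc M)))"
    using qgeom_mult[of "Suc (Suc (N + M))"]
    by (simp add: inverse_qpoch_Suc[of "Suc (N + M)"] mult.left_commute del: power_Suc)
  also have "qpoch N * qpoch M * ((1 - fps_X ^ Suc (Suc (N + M))) * inverse (qpoch (Suc (N + Suc M))))
      - fps_X ^ Suc N * (qpoch N * qpoch (Suc M) * inverse (qpoch (Suc (N + Suc M))))
      = qpoch (Suc N) * qpoch M * inverse (qpoch (Suc (Suc N + M)))"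
    unfolding qpoch_Suc[of M] qpoch_Suc[of N] by (simp add: algebra_simps power_add)
  finally show ?case by (simp only: B_def)
qed


subsection \<open>Graph series of tripartite graphs\<close>

lemma infsum_PiE_Un:
  assumes "I \<inter> J = {}" and fin: "coeff_finite F (I \<union> J \<rightarrow>\<^sub>E B)"
  shows "f \<in> I \<rightarrow>\<^sub>E B \<Longrightarrow> coeff_finite (\<lambda>g. F (\<lambda>i. if i \<in> I then f i else g i)) (J \<rightarrow>\<^sub>E B)"
    and "infsum F (I \<union> J \<rightarrow>\<^sub>E B) =
      infsum (\<lambda>f. infsum (\<lambda>g. F (\<lambda>i. if i \<in> I then f i else g i)) (J \<rightarrow>\<^sub>E B)) (I \<rightarrow>\<^sub>E B)"
proof -
  let ?h = "\<lambda>(f, g) i. if i \<in> I then f i else g i"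
  let ?G = "\<lambda>f g. F (\<lambda>i. if i \<in> I then f i else g i)"
  note bij = bij_betw_PiE_Un[OF assms(1), of B]
  have eq: "F (?h p) = (case p of (f, g) \<Rightarrow> ?G f g)" for p by (cases p) simp
  have fin': "coeff_finite (\<lambda>(f, g). ?G f g) ((I \<rightarrow>\<^sub>E B) \<times> (J \<rightarrow>\<^sub>E B))"
    using coeff_finite_reindex[OF bij, of F] fin by (simp only: eq)
  show "f \<in> I \<rightarrow>\<^sub>E B \<Longrightarrow> coeff_finite (?G f) (J \<rightarrow>\<^sub>E B)"
    by (rule coeff_finite_inner[OF fin'])
  show "infsum F (I \<union> J \<rightarrow>\<^sub>E B) = infsum (\<lambda>f. infsum (?G f) (J \<rightarrow>\<^sub>E B)) (I \<rightarrow>\<^sub>E B)"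
    using infsum_reindex_bij_betw[OF bij, of F] infsum_fps_Times[OF fin'] by (simp only: eq)
qed

text \<open>\<open>D\<close> holds one orientation of each edge. The symmetric double sum runs over
  \<open>D\<close> and its converse, which are disjoint, so the halving is exact; a loop would be
  its own reversal and is thereby excluded.\<close>

lemma graph_exponent_oriented:
  assumes D: "D \<subseteq> {1..r} \<times> {1..r}" "\<And>u v. (u, v) \<in> D \<Longrightarrow> (v, u) \<notin> D"
  shows "graph_exponent r ((\<lambda>(u, v). {u, v}) ` D) n
    = (\<Sum>(u, v)\<in>D. n u * n v) + (\<Sum>i=1..r. n i)"
proof -
  let ?E = "(\<lambda>(u, v). {u, v}) ` D"
  have fin: "finite D" using D(1) by (rule finite_subset) auto
  have adj: "adj_matrix ?E i j = (if (i, j) \<in> D \<union> D\<inverse> then 1 else 0)" for i j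
    by (auto simp: adj_matrix_def doubleton_eq_iff image_iff)
  have "(\<Sum>i=1..r. \<Sum>j=1..r. n i * adj_matrix ?E i j * n j)
      = (\<Sum>(i, j)\<in>{1..r} \<times> {1..r}. n i * adj_matrix ?E i j * n j)"
    by (rule sum.cartesian_product)
  also have "\<dots> = (\<Sum>(i, j)\<in>D \<union> D\<inverse>. n i * n j)"
    by (rule sum.mono_neutral_cong_right) (use D(1) in \<open>auto simp: adj split: if_splits\<close>)
  also have "\<dots> = (\<Sum>(i, j)\<in>D. n i * n j) + (\<Sum>(i, j)\<in>D\<inverse>. n i * n j)"
    by (rule sum.union_disjoint) (use fin D(2) in auto)
  also have "(\<Sum>(i, j)\<in>D\<inverse>. n i * n j) = (\<Sum>(i, j)\<in>D. n i * n j)"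
    by (rule sum.reindex_bij_witness[of _ prod.swap prod.swap]) auto
  finally show ?thesis by (simp add: graph_exponent_def)
qed

text \<open>The factor of a vertex with value v whose neighbours fixed before it have total value w:
  the edges contribute q^(vw), the linear term q^v.\<close>

definition qterm :: "nat \<Rightarrow> nat \<Rightarrow> rat fps" where
  "qterm w v = fps_X ^ (v * Suc w) * inverse (qpoch v)"

lemma infsum_qterm: "infsum (qterm w) UNIV = qpoch w * inverse qpoch_inf"
  unfolding qterm_def[abs_def] by (rule infsum_Euler)

lemma inverse_prod_qpoch: "finite I \<Longrightarrow> inverse (\<Prod>i\<in>I. qpoch (n i)) = (\<Prod>i\<in>I. inverse (qpoch (n i)))"
  by (induction I rule: finite_induct) (simp_all add: fps_inverse_mult)

lemma prod_qpoch_nth_0: "finite I \<Longrightarrow> fps_nth (\<Prod>i\<in>I. qpoch (n i)) 0 = 1"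
  by (induction I rule: finite_induct) (simp_all add: qpoch_nth_0)

text \<open>Every edge is recorded at its later endpoint in the order \<open>A\<close>,
  \<open>B\<close>, \<open>L\<close>: \<open>nb i\<close> lists the earlier neighbours of i. Once
  the values on \<open>A\<close> and \<open>B\<close> are fixed, the sum over \<open>L\<close>
  splits into one Euler sum per vertex; the sum over \<open>B\<close> is left unevaluated.\<close>

lemma graph_series_tripartite:
  fixes A B L :: "nat set"
  assumes V: "{1..r} = A \<union> (B \<union> L)" and disj: "A \<inter> (B \<union> L) = {}" "B \<inter> L = {}"
    and nbB: "\<And>i. i \<in> B \<Longrightarrow> nb i \<subseteq> A" and nbL: "\<And>i. i \<in> L \<Longrightarrow> nb i \<subseteq> A \<union> B"
    and E: "E = {{i, j} | i j. i \<in> B \<union> L \<and> j \<in> nb i}"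
  shows "graph_series r E =
    infsum (\<lambda>a. fps_X ^ (\<Sum>i\<in>A. a i) * (\<Prod>i\<in>A. inverse (qpoch (a i))) *
      infsum (\<lambda>b. (\<Prod>i\<in>B. qterm (\<Sum>j\<in>nb i. a j) (b i)) *
        (\<Prod>i\<in>L. qpoch (\<Sum>j\<in>nb i. if j \<in> A then a j else b j) * inverse qpoch_inf))
      (B \<rightarrow>\<^sub>E UNIV)) (A \<rightarrow>\<^sub>E UNIV)"
proof -
  define F where "F n = fps_X ^ graph_exponent r E n / (\<Prod>i=1..r. qpoch (n i))" for n
  have finV: "finite (A \<union> (B \<union> L))" unfolding V[symmetric] by simp
  hence fin: "finite A" "finite B" "finite L" by auto
  have finnb: "finite (nb i)" if "i \<in> B \<union> L" for i
    using that nbB nbL fin by (meson UnE finite_UnI finite_subset)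
  have ex: "graph_exponent r E n
      = (\<Sum>i\<in>A. n i) + (\<Sum>i\<in>B \<union> L. n i * Suc (\<Sum>j\<in>nb i. n j))" for n
  proof -
    define D where "D = Sigma (B \<union> L) nb"
    have "E = (\<lambda>(u, v). {u, v}) ` D" by (auto simp: E D_def)
    moreover have "D \<subseteq> {1..r} \<times> {1..r}"
      unfolding D_def V using nbB nbL by blast
    moreover have "(v, u) \<notin> D" if "(u, v) \<in> D" for u v
      using that nbB nbL disj unfolding D_def by blast
    ultimately have "graph_exponent r E n = (\<Sum>(u, v)\<in>D. n u * n v) + (\<Sum>i=1..r. n i)"
      using graph_exponent_oriented by blast
    also have "(\<Sum>(u, v)\<in>D. n u * n v) = (\<Sum>i\<in>B \<union> L. \<Sum>j\<in>nb i. n i * n j)"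
      unfolding D_def by (rule sum.Sigma[symmetric]) (use fin finnb in auto)
    also have "(\<Sum>i=1..r. n i) = (\<Sum>i\<in>A. n i) + (\<Sum>i\<in>B \<union> L. n i)"
      unfolding V by (rule sum.union_disjoint) (use fin disj in auto)
    finally show ?thesis by (simp add: sum_distrib_left sum.distrib)
  qed
  have F1: "F n = fps_X ^ graph_exponent r E n * inverse (\<Prod>i=1..r. qpoch (n i))" for n
    unfolding F_def by (rule fps_divide_unit) (simp add: prod_qpoch_nth_0)
  have F2: "F n = fps_X ^ (\<Sum>i\<in>A. n i) * (\<Prod>i\<in>A. inverse (qpoch (n i))) *
      ((\<Prod>i\<in>B. qterm (\<Sum>j\<in>nb i. n j) (n i)) * (\<Prod>i\<in>L. qterm (\<Sum>j\<in>nb i. n j) (n i)))" for n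
  proof -
    have "F n = fps_X ^ (\<Sum>i\<in>A. n i) * (\<Prod>i\<in>A. inverse (qpoch (n i))) *
        (\<Prod>i\<in>B \<union> L. qterm (\<Sum>j\<in>nb i. n j) (n i))"
    proof -
      have "inverse (\<Prod>i=1..r. qpoch (n i))
          = (\<Prod>i\<in>A. inverse (qpoch (n i))) * (\<Prod>i\<in>B \<union> L. inverse (qpoch (n i)))"
        unfolding V inverse_prod_qpoch[OF finV]
        by (rule prod.union_disjoint) (use fin disj in auto)
      thus ?thesis
        unfolding F1 ex qterm_def prod.distrib by (simp only: power_add power_sum mult_ac)
    qed
    also have "(\<Prod>i\<in>B \<union> L. qterm (\<Sum>j\<in>nb i. n j) (n i)) =
        (\<Prod>i\<in>B. qterm (\<Sum>j\<in>nb i. n j) (n i)) * (\<Prod>i\<in>L. qterm (\<Sum>j\<in>nb i. n j) (n i))"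
      by (rule prod.union_disjoint) (use fin disj in auto)
    finally show ?thesis .
  qed
  have finF: "coeff_finite F (A \<union> (B \<union> L) \<rightarrow>\<^sub>E UNIV)"
    unfolding F1
  proof (rule coeff_finite_X_power)
    fix m
    have "{n \<in> A \<union> (B \<union> L) \<rightarrow>\<^sub>E UNIV. graph_exponent r E n \<le> m}
        \<subseteq> {n \<in> {1..r} \<rightarrow>\<^sub>E UNIV. (\<Sum>i\<in>{1..r}. n i) \<le> m}"
      unfolding V[symmetric] by (auto simp: graph_exponent_def)
    thus "finite {n \<in> A \<union> (B \<union> L) \<rightarrow>\<^sub>E UNIV. graph_exponent r E n \<le> m}"
      using finite_PiE_sum_le[of "{1..r}" m] finite_subset by blast
  qed
  have "graph_series r E = infsum F (A \<union> (B \<union> L) \<rightarrow>\<^sub>E UNIV)"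
    unfolding graph_series_def F_def V ..
  also have "\<dots> = infsum (\<lambda>a. infsum (\<lambda>h. F (\<lambda>i. if i \<in> A then a i else h i)) (B \<union> L \<rightarrow>\<^sub>E UNIV))
      (A \<rightarrow>\<^sub>E UNIV)"
    by (rule infsum_PiE_Un[OF disj(1) finF])
  also have "\<dots> = infsum (\<lambda>a. fps_X ^ (\<Sum>i\<in>A. a i) * (\<Prod>i\<in>A. inverse (qpoch (a i))) *
      infsum (\<lambda>b. (\<Prod>i\<in>B. qterm (\<Sum>j\<in>nb i. a j) (b i)) *
        (\<Prod>i\<in>L. qpoch (\<Sum>j\<in>nb i. if j \<in> A then a j else b j) * inverse qpoch_inf))
      (B \<rightarrow>\<^sub>E UNIV)) (A \<rightarrow>\<^sub>E UNIV)"
  proof (rule infsum_cong)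
    fix a :: "nat \<Rightarrow> nat" assume a: "a \<in> A \<rightarrow>\<^sub>E UNIV"
    define C where "C = fps_X ^ (\<Sum>i\<in>A. a i) * (\<Prod>i\<in>A. inverse (qpoch (a i)))"
    define G where "G b = (\<Prod>i\<in>B. qterm (\<Sum>j\<in>nb i. a j) (b i)) *
        (\<Prod>i\<in>L. qpoch (\<Sum>j\<in>nb i. if j \<in> A then a j else b j) * inverse qpoch_inf)" for b
    \<comment> \<open>Allows \<open>C\<close> to be pulled out of the sum over \<open>B\<close>.
      Each exponent b_i (w_i + 1) is at least b_i, so the sublevel sets are finite.\<close>
    have finG: "coeff_finite G (B \<rightarrow>\<^sub>E UNIV)"
    proof -
      define w where "w i = (\<Sum>j\<in>nb i. a j)" for i
      have "coeff_finite (\<lambda>b. fps_X ^ (\<Sum>i\<in>B. b i * Suc (w i)) * ((\<Prod>i\<in>B. inverse (qpoch (b i))) *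
          (\<Prod>i\<in>L. qpoch (\<Sum>j\<in>nb i. if j \<in> A then a j else b j) * inverse qpoch_inf)))
          (B \<rightarrow>\<^sub>E UNIV)"
      proof (rule coeff_finite_X_power)
        fix m
        have "(\<Sum>i\<in>B. b i) \<le> (\<Sum>i\<in>B. b i * Suc (w i))" for b
          by (rule sum_mono) simp
        hence "{b \<in> B \<rightarrow>\<^sub>E UNIV. (\<Sum>i\<in>B. b i * Suc (w i)) \<le> m}
            \<subseteq> {b \<in> B \<rightarrow>\<^sub>E UNIV. (\<Sum>i\<in>B. b i) \<le> m}"
          using le_trans by blast
        thus "finite {b \<in> B \<rightarrow>\<^sub>E UNIV. (\<Sum>i\<in>B. b i * Suc (w i)) \<le> m}"
          using finite_PiE_sum_le[OF fin(2), of m] finite_subset by blast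
      qed
      also have "?this \<longleftrightarrow> coeff_finite G (B \<rightarrow>\<^sub>E UNIV)"
        by (rule coeff_finite_cong[OF refl])
           (simp only: G_def qterm_def prod.distrib power_sum w_def mult.assoc)
      finally show ?thesis .
    qed
    note finA = infsum_PiE_Un(1)[OF disj(1) finF a]
    have "infsum (\<lambda>h. F (\<lambda>i. if i \<in> A then a i else h i)) (B \<union> L \<rightarrow>\<^sub>E UNIV)
      = infsum (\<lambda>b. infsum (\<lambda>f. F (\<lambda>i. if i \<in> A then a i else if i \<in> B then b i else f i))
          (L \<rightarrow>\<^sub>E UNIV)) (B \<rightarrow>\<^sub>E UNIV)"
      by (rule infsum_PiE_Un[OF disj(2) finA])
    also have "\<dots> = infsum (\<lambda>b. C * G b) (B \<rightarrow>\<^sub>E UNIV)"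
    proof (rule infsum_cong)
      fix b :: "nat \<Rightarrow> nat" assume b: "b \<in> B \<rightarrow>\<^sub>E UNIV"
      define N where "N i = (\<Sum>j\<in>nb i. if j \<in> A then a j else b j)" for i
      have "F (\<lambda>i. if i \<in> A then a i else if i \<in> B then b i else f i)
          = C * (\<Prod>i\<in>B. qterm (\<Sum>j\<in>nb i. a j) (b i)) * (\<Prod>i\<in>L. qterm (N i) (f i))" for f
      proof -
        let ?n = "\<lambda>i. if i \<in> A then a i else if i \<in> B then b i else f i"
        have "(\<Sum>i\<in>A. ?n i) = (\<Sum>i\<in>A. a i)" by simp
        moreover have "(\<Prod>i\<in>A. inverse (qpoch (?n i))) = (\<Prod>i\<in>A. inverse (qpoch (a i)))" by simp
        moreover have "(\<Prod>i\<in>B. qterm (\<Sum>j\<in>nb i. ?n j) (?n i)) = (\<Prod>i\<in>B. qterm (\<Sum>j\<in>nb i. a j) (b i))"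
        proof (rule prod.cong[OF refl])
          fix i assume i: "i \<in> B"
          have "(\<Sum>j\<in>nb i. ?n j) = (\<Sum>j\<in>nb i. a j)" using nbB[OF i] by (intro sum.cong) auto
          moreover have "?n i = b i" using i disj by auto
          ultimately show "qterm (\<Sum>j\<in>nb i. ?n j) (?n i) = qterm (\<Sum>j\<in>nb i. a j) (b i)" by simp
        qed
        moreover have "(\<Prod>i\<in>L. qterm (\<Sum>j\<in>nb i. ?n j) (?n i)) = (\<Prod>i\<in>L. qterm (N i) (f i))"
        proof (rule prod.cong[OF refl])
          fix i assume i: "i \<in> L"
          have "(\<Sum>j\<in>nb i. ?n j) = N i" unfolding N_def using nbL[OF i] by (intro sum.cong) auto
          moreover have "?n i = f i" using i disj by auto
          ultimately show "qterm (\<Sum>j\<in>nb i. ?n j) (?n i) = qterm (N i) (f i)" by simp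
        qed
        ultimately show ?thesis unfolding F2 C_def by (simp only: mult.assoc)
      qed
      hence "infsum (\<lambda>f. F (\<lambda>i. if i \<in> A then a i else if i \<in> B then b i else f i)) (L \<rightarrow>\<^sub>E UNIV)
          = infsum (\<lambda>f. C * (\<Prod>i\<in>B. qterm (\<Sum>j\<in>nb i. a j) (b i)) * (\<Prod>i\<in>L. qterm (N i) (f i))) (L \<rightarrow>\<^sub>E UNIV)"
        by simp
      also have "\<dots> = C * (\<Prod>i\<in>B. qterm (\<Sum>j\<in>nb i. a j) (b i)) * (\<Prod>i\<in>L. infsum (qterm (N i)) UNIV)"
      proof -
        have q: "coeff_finite (qterm (N i)) UNIV" for i
          unfolding qterm_def by (rule coeff_finite_power_nat) simp
        note fin_prod = coeff_finite_prod_PiE[of L "\<lambda>i. qterm (N i)" UNIV, OF fin(3) q]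
        show ?thesis by (simp only: infsum_fps_cmult[OF fin_prod(1)] fin_prod(2))
      qed
      also have "\<dots> = C * G b"
        by (simp only: infsum_qterm G_def N_def mult.assoc)
      finally show "infsum (\<lambda>f. F (\<lambda>i. if i \<in> A then a i else if i \<in> B then b i else f i)) (L \<rightarrow>\<^sub>E UNIV)
          = C * G b" .
    qed
    also have "\<dots> = C * infsum G (B \<rightarrow>\<^sub>E UNIV)" by (rule infsum_fps_cmult[OF finG])
    finally show "infsum (\<lambda>h. F (\<lambda>i. if i \<in> A then a i else h i)) (B \<union> L \<rightarrow>\<^sub>E UNIV)
        = fps_X ^ (\<Sum>i\<in>A. a i) * (\<Prod>i\<in>A. inverse (qpoch (a i))) * infsum (\<lambda>b.
            (\<Prod>i\<in>B. qterm (\<Sum>j\<in>nb i. a j) (b i)) *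
            (\<Prod>i\<in>L. qpoch (\<Sum>j\<in>nb i. if j \<in> A then a j else b j) * inverse qpoch_inf)) (B \<rightarrow>\<^sub>E UNIV)"
      unfolding C_def G_def .
  qed
  finally show ?thesis .
qed

lemma coeff_finite_qterm:
  "coeff_finite (\<lambda>v. qterm w v * G v) UNIV"
  unfolding qterm_def mult.assoc by (rule coeff_finite_power_nat) simp

lemma infsum_qterm_qbeta:
  "infsum (\<lambda>v. qterm M v * (qpoch (N + v) * c)) UNIV
     = qpoch N * qpoch M * inverse (qpoch (Suc (N + M))) * c"
proof -
  have "infsum (\<lambda>v. qterm M v * (qpoch (N + v) * c)) UNIV = infsum (\<lambda>v. qterm M v * qpoch (N + v)) UNIV * c"
    unfolding mult.assoc[symmetric] by (rule infsum_fps_multc[OF coeff_finite_qterm])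
  also have "infsum (\<lambda>v. qterm M v * qpoch (N + v)) UNIV
      = qpoch N * qpoch M * inverse (qpoch (Suc (N + M)))"
    using infsum_qbeta[of M N] by (simp only: qterm_def mult_ac)
  finally show ?thesis .
qed

text \<open>
  Covers both families: \<open>P s = {}\<close> for the tree, \<open>P s = {3 * s + 2}\<close> for \<open>\<Gamma>\<close>.
\<close>

lemma graph_series_legs:
  fixes A K :: "nat set" and b c :: "nat \<Rightarrow> nat" and P Q :: "nat \<Rightarrow> nat set"
  assumes V: "{1..r} = A \<union> (b ` K \<union> insert z (c ` K))"
    and disj: "A \<inter> b ` K = {}" "A \<inter> c ` K = {}" "z \<notin> A" "z \<notin> b ` K" "z \<notin> c ` K" "b ` K \<inter> c ` K = {}"
    and inj: "inj_on b K" "inj_on c K"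
    and PQ: "\<And>s. s \<in> K \<Longrightarrow> P s \<subseteq> A" "\<And>s. s \<in> K \<Longrightarrow> Q s \<subseteq> A"
    and E: "E = {{z, j} | j. j \<in> A} \<union> {{c s, j} | s j. s \<in> K \<and> j \<in> insert (b s) (P s)}
      \<union> {{b s, j} | s j. s \<in> K \<and> j \<in> Q s}"
  shows "graph_series r E = inverse qpoch_inf ^ Suc (card K) *
    infsum (\<lambda>a. fps_X ^ (\<Sum>i\<in>A. a i) * (\<Prod>i\<in>A. inverse (qpoch (a i))) * qpoch (\<Sum>i\<in>A. a i) *
      (\<Prod>s\<in>K. qpoch (\<Sum>j\<in>P s. a j) * qpoch (\<Sum>j\<in>Q s. a j) *
        inverse (qpoch (Suc ((\<Sum>j\<in>P s. a j) + (\<Sum>j\<in>Q s. a j)))))) (A \<rightarrow>\<^sub>E UNIV)"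
proof -
  \<comment> \<open>The classes are \<open>A\<close>, the vertices \<open>b s\<close>, and
    \<open>z\<close> together with the vertices \<open>c s\<close>; \<open>the_inv_into\<close>
    recovers the index of a leg from its vertex.\<close>
  define nb where "nb i = (if i = z then A else if i \<in> b ` K then Q (the_inv_into K b i)
      else insert (b (the_inv_into K c i)) (P (the_inv_into K c i)))" for i
  have nb_z: "nb z = A" by (simp add: nb_def)
  have nb_b: "nb (b s) = Q s" if "s \<in> K" for s
    using that disj inj by (auto simp: nb_def the_inv_into_f_f)
  have nb_c: "nb (c s) = insert (b s) (P s)" if "s \<in> K" for s
  proof -
    have "c s \<noteq> z" "c s \<notin> b ` K" using that disj by auto
    thus ?thesis using that inj by (simp add: nb_def the_inv_into_f_f)
  qed
  have finV: "finite (A \<union> (b ` K \<union> insert z (c ` K)))" unfolding V[symmetric] by simp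
  have fin: "finite A" "finite K" "finite (c ` K)" using finV inj by (auto dest: finite_imageD)
  define p where "p s a = (\<Sum>j\<in>P s. a j)" for s and a :: "nat \<Rightarrow> nat"
  define d where "d s a = (\<Sum>j\<in>Q s. a j)" for s and a :: "nat \<Rightarrow> nat"
  define C where "C a = fps_X ^ (\<Sum>i\<in>A. a i) * (\<Prod>i\<in>A. inverse (qpoch (a i)))" for a
  have "graph_series r E =
    infsum (\<lambda>a. C a * infsum (\<lambda>g. (\<Prod>i\<in>b ` K. qterm (\<Sum>j\<in>nb i. a j) (g i)) *
        (\<Prod>i\<in>insert z (c ` K). qpoch (\<Sum>j\<in>nb i. if j \<in> A then a j else g j) * inverse qpoch_inf))
      (b ` K \<rightarrow>\<^sub>E UNIV)) (A \<rightarrow>\<^sub>E UNIV)"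
    unfolding C_def
  proof (rule graph_series_tripartite[OF V])
    show "E = {{i, j} | i j. i \<in> b ` K \<union> insert z (c ` K) \<and> j \<in> nb i}"
    proof -
      have "{{i, j} | i j. i \<in> b ` K \<union> insert z (c ` K) \<and> j \<in> nb i}
        = {{z, j} | j. j \<in> nb z} \<union> {{c s, j} | s j. s \<in> K \<and> j \<in> nb (c s)}
          \<union> {{b s, j} | s j. s \<in> K \<and> j \<in> nb (b s)}" by blast
      also have "\<dots> = E"
        unfolding E nb_z by (simp only: nb_b nb_c cong: conj_cong)
      finally show ?thesis ..
    qed
  qed (use disj in \<open>auto simp: nb_z nb_b nb_c dest: subsetD[OF PQ(1)] subsetD[OF PQ(2)]\<close>)
  also have "\<dots> = infsum (\<lambda>a. inverse qpoch_inf ^ Suc (card K) * (C a * qpoch (\<Sum>i\<in>A. a i) *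
      (\<Prod>s\<in>K. qpoch (p s a) * qpoch (d s a) * inverse (qpoch (Suc (p s a + d s a)))))) (A \<rightarrow>\<^sub>E UNIV)"
  proof (rule infsum_cong)
    fix a :: "nat \<Rightarrow> nat" assume "a \<in> A \<rightarrow>\<^sub>E UNIV"
    \<comment> \<open>What leg s contributes once \<open>c s\<close> is summed out: v is the value
      at \<open>b s\<close>, whose neighbours in \<open>A\<close> total \<open>d s a\<close>, and
      the neighbours of \<open>c s\<close> total \<open>p s a + v\<close>. So the q-beta sum applies
      with N = \<open>p s a\<close> and M = \<open>d s a\<close>.\<close>
    define H where "H s v = qterm (d s a) v * (qpoch (p s a + v) * inverse qpoch_inf)" for s v
    define G where "G i = H (the_inv_into K b i)" for i
    have G: "G (b s) = H s" if "s \<in> K" for s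
      using that inj by (simp add: G_def the_inv_into_f_f)
    have eq: "(\<Prod>i\<in>b ` K. qterm (\<Sum>j\<in>nb i. a j) (g i)) *
        (\<Prod>i\<in>insert z (c ` K). qpoch (\<Sum>j\<in>nb i. if j \<in> A then a j else g j) * inverse qpoch_inf)
        = qpoch (\<Sum>i\<in>A. a i) * inverse qpoch_inf * (\<Prod>i\<in>b ` K. G i (g i))" for g
    proof -
      have 1: "(\<Prod>i\<in>b ` K. qterm (\<Sum>j\<in>nb i. a j) (g i)) = (\<Prod>s\<in>K. qterm (d s a) (g (b s)))"
        unfolding prod.reindex[OF inj(1)] o_def by (rule prod.cong) (simp_all add: nb_b d_def)
      have nbc: "(\<Sum>j\<in>nb (c s). if j \<in> A then a j else g j) = p s a + g (b s)" if s: "s \<in> K" for s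
      proof -
        have "b s \<notin> A" using s disj by auto
        moreover have "finite (P s)" using PQ(1)[OF s] fin finite_subset by auto
        moreover have "(\<Sum>j\<in>P s. if j \<in> A then a j else g j) = p s a"
          unfolding p_def using PQ(1)[OF s] by (intro sum.cong) auto
        moreover have "b s \<notin> P s" using PQ(1)[OF s] \<open>b s \<notin> A\<close> by auto
        ultimately show ?thesis by (simp add: nb_c[OF s])
      qed
      have 2: "(\<Prod>i\<in>c ` K. qpoch (\<Sum>j\<in>nb i. if j \<in> A then a j else g j) * inverse qpoch_inf)
          = (\<Prod>s\<in>K. qpoch (p s a + g (b s)) * inverse qpoch_inf)"
        unfolding prod.reindex[OF inj(2)] o_def by (rule prod.cong) (simp_all add: nbc)
      have 3: "(\<Prod>i\<in>b ` K. G i (g i)) = (\<Prod>s\<in>K. H s (g (b s)))"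
        unfolding prod.reindex[OF inj(1)] o_def by (rule prod.cong) (simp_all add: G)
      have 4: "(\<Sum>j\<in>nb z. if j \<in> A then a j else g j) = (\<Sum>i\<in>A. a i)"
        by (simp add: nb_z)
      show ?thesis
        unfolding prod.insert[OF fin(3) disj(5)] 1 2 3 4 by (simp only: H_def prod.distrib mult_ac)
    qed
    have fG: "coeff_finite (G i) UNIV" for i
      unfolding G_def H_def by (rule coeff_finite_qterm)
    note fG = coeff_finite_prod_PiE[of "b ` K" G UNIV, OF finite_imageI[OF fin(2)] fG]
    have "(\<Prod>i\<in>b ` K. infsum (G i) UNIV) = (\<Prod>s\<in>K. infsum (H s) UNIV)"
      unfolding prod.reindex[OF inj(1)] o_def by (rule prod.cong) (simp_all add: G)
    \<comment> \<open>Each leg leaves one factor 1/(q)_\<infinity>; the vertex \<open>z\<close>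
      supplies the additional one in \<open>Suc (card K)\<close>.\<close>
    also have "\<dots> = (\<Prod>s\<in>K. qpoch (p s a) * qpoch (d s a) * inverse (qpoch (Suc (p s a + d s a))))
        * inverse qpoch_inf ^ card K"
      unfolding H_def infsum_qterm_qbeta prod.distrib by simp
    finally have "infsum (\<lambda>g. qpoch (\<Sum>i\<in>A. a i) * inverse qpoch_inf * (\<Prod>i\<in>b ` K. G i (g i))) (b ` K \<rightarrow>\<^sub>E UNIV)
       = qpoch (\<Sum>i\<in>A. a i) * inverse qpoch_inf *
         ((\<Prod>s\<in>K. qpoch (p s a) * qpoch (d s a) * inverse (qpoch (Suc (p s a + d s a))))
        * inverse qpoch_inf ^ card K)"
      by (simp only: infsum_fps_cmult[OF fG(1)] fG(2))
    thus "C a * infsum (\<lambda>g. (\<Prod>i\<in>b ` K. qterm (\<Sum>j\<in>nb i. a j) (g i)) *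
        (\<Prod>i\<in>insert z (c ` K). qpoch (\<Sum>j\<in>nb i. if j \<in> A then a j else g j) * inverse qpoch_inf))
      (b ` K \<rightarrow>\<^sub>E UNIV) = inverse qpoch_inf ^ Suc (card K) * (C a * qpoch (\<Sum>i\<in>A. a i) *
      (\<Prod>s\<in>K. qpoch (p s a) * qpoch (d s a) * inverse (qpoch (Suc (p s a + d s a)))))"
      unfolding eq by (simp only: power_Suc mult_ac)
  qed
  also have "\<dots> = inverse qpoch_inf ^ Suc (card K) * infsum (\<lambda>a. C a * qpoch (\<Sum>i\<in>A. a i) *
      (\<Prod>s\<in>K. qpoch (p s a) * qpoch (d s a) * inverse (qpoch (Suc (p s a + d s a))))) (A \<rightarrow>\<^sub>E UNIV)"
  proof (rule infsum_fps_cmult)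
    show "coeff_finite (\<lambda>a. C a * qpoch (\<Sum>i\<in>A. a i) *
      (\<Prod>s\<in>K. qpoch (p s a) * qpoch (d s a) * inverse (qpoch (Suc (p s a + d s a))))) (A \<rightarrow>\<^sub>E UNIV)"
      unfolding C_def mult.assoc
      by (rule coeff_finite_X_power) (rule finite_PiE_sum_le[OF fin(1)])
  qed
  finally show ?thesis by (simp only: C_def p_def d_def)
qed


subsection \<open>Reduction to nested sums\<close>

lemma infsum_PiE_singleton:
  assumes "coeff_finite F UNIV"
  shows "infsum (\<lambda>f. F (f i)) ({i} \<rightarrow>\<^sub>E UNIV) = infsum F UNIV"
  using coeff_finite_prod_PiE(2)[of "{i}" "\<lambda>_. F" UNIV] assms by simp

lemma qpoch_mult_inverse_Suc: "qpoch n * inverse (qpoch (Suc n)) = qgeom (Suc n)"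
  by (simp only: inverse_qpoch_Suc mult.assoc[symmetric] qpoch_inverse mult_1_left)

section \<open>The star-shaped tree\<close>

text \<open>The form required by \<open>graph_series_legs\<close>: \<open>A\<close> is the centre,
  \<open>z\<close> the end of the short leg, and leg s has inner vertex \<open>b s\<close> = 2s and
  outer vertex \<open>c s\<close> = 2s + 1, with \<open>P s\<close> empty.\<close>

lemma T_edges_eq:
  "T_edges k = {{2 * k + 2, j} | j. j \<in> {1}}
     \<union> {{2 * s + 1, j} | s j. s \<in> {1..k} \<and> j \<in> insert (2 * s) {}}
     \<union> {{2 * s, j} | s j. s \<in> {1..k} \<and> j \<in> {1}}"
  unfolding T_edges_def by (auto simp: insert_commute)

lemma graph_series_T:
  "graph_series (2 * k + 2) (T_edges k) =
     inverse qpoch_inf ^ Suc k * infsum (\<lambda>n. fps_X ^ n * qgeom (Suc n) ^ k) UNIV"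
proof -
  have V: "{1..2 * k + 2} = {1} \<union> ((\<lambda>s. 2 * s) ` {1..k} \<union> insert (2 * k + 2) ((\<lambda>s. 2 * s + 1) ` {1..k}))"
  proof (intro equalityI subsetI)
    fix i assume i: "i \<in> {1..2 * k + 2}"
    show "i \<in> {1} \<union> ((\<lambda>s. 2 * s) ` {1..k} \<union> insert (2 * k + 2) ((\<lambda>s. 2 * s + 1) ` {1..k}))"
    proof (cases "even i")
      case True
      then obtain s where "i = 2 * s" by (elim evenE)
      thus ?thesis using i by (cases "s = k + 1") auto
    next
      case False
      then obtain s where "i = 2 * s + 1" by (elim oddE)
      thus ?thesis using i by (cases "s = 0") auto
    qed
  qed auto
  have "graph_series (2 * k + 2) (T_edges k) = inverse qpoch_inf ^ Suc (card {1..k}) *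
    infsum (\<lambda>a. fps_X ^ (\<Sum>i\<in>{1::nat}. a i) * (\<Prod>i\<in>{1::nat}. inverse (qpoch (a i))) * qpoch (\<Sum>i\<in>{1::nat}. a i) *
      (\<Prod>s\<in>{1..k}. qpoch (\<Sum>j\<in>{}. a j) * qpoch (\<Sum>j\<in>{1}. a j) *
        inverse (qpoch (Suc ((\<Sum>j\<in>{}. a j) + (\<Sum>j\<in>{1}. a j)))))) ({1 :: nat} \<rightarrow>\<^sub>E UNIV)"
  proof (rule graph_series_legs[OF V])
    show "(\<lambda>s. 2 * s) ` {1..k} \<inter> (\<lambda>s. 2 * s + 1) ` {1..k} = {}" by (auto, presburger)
  qed (auto simp: T_edges_eq inj_on_def, presburger+)
  also have "\<dots> = inverse qpoch_inf ^ Suc k * infsum (\<lambda>a. fps_X ^ a 1 * qgeom (Suc (a 1)) ^ k) ({1 :: nat} \<rightarrow>\<^sub>E UNIV)"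
  proof -
    \<comment> \<open>The factor (q)_n contributed by the short leg cancels the denominator of the
      centre.\<close>
    have "fps_X ^ n * inverse (qpoch n) * qpoch n = fps_X ^ n" for n
      using qpoch_inverse[of n] by (simp only: mult.assoc mult.commute[of "inverse _"] mult_1_right)
    note cancel = this
    show ?thesis by (simp add: qpoch_mult_inverse_Suc cancel)
  qed
  also have "infsum (\<lambda>a. fps_X ^ a 1 * qgeom (Suc (a 1)) ^ k) ({1 :: nat} \<rightarrow>\<^sub>E UNIV)
      = infsum (\<lambda>n. fps_X ^ n * qgeom (Suc n) ^ k) UNIV"
    by (rule infsum_PiE_singleton) (rule coeff_finite_X_power, simp)
  finally show ?thesis .
qed

section \<open>The graph \<Gamma>\<close>

text \<open>Regrouping with \<open>z\<close> = 1, \<open>c s\<close> = 3s + 3, \<open>b s\<close> =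
  3s + 4. The edges from 3s + 4 to 3t + 2 with s < t have four sources: the cycle edge from 4 to 5,
  the edges from 4 to 3t + 2, the path edges (t = s + 1) and the chords (t \<ge> s + 2). Path edges
  are sorted by residue modulo 3.\<close>

lemma Gamma_edges_eq:
  assumes "k \<ge> 1"
  shows "Gamma_edges k = {{1, j} | j. j \<in> (\<lambda>t. 3 * t + 2) ` {..k}}
     \<union> {{3 * s + 3, j} | s j. s \<in> {..<k} \<and> j \<in> insert (3 * s + 4) {3 * s + 2}}
     \<union> {{3 * s + 4, j} | s j. s \<in> {..<k} \<and> j \<in> (\<lambda>t. 3 * t + 2) ` {Suc s..k}}" (is "_ = ?R")
proof (rule equalityI)
  have R1: "{1, 3 * t + 2} \<in> ?R" if "t \<le> k" for t using that by auto
  have R2: "{3 * s + 3, 3 * s + 4} \<in> ?R" "{3 * s + 3, 3 * s + 2} \<in> ?R" if "s < k" for s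
    using that by auto
  have R3: "{3 * s + 4, 3 * t + 2} \<in> ?R" if "s < t" "t \<le> k" for s t
  proof -
    have "3 * t + 2 \<in> (\<lambda>t. 3 * t + 2) ` {Suc s..k}" "s \<in> {..<k}" using that by auto
    thus ?thesis by blast
  qed
  have path: "{i, i + 1} \<in> ?R" if i: "5 \<le> i" "i \<le> 3 * k + 1" for i
  proof -
    have "i mod 3 = 0 \<or> i mod 3 = 1 \<or> i mod 3 = 2" by auto
    then consider s where "i = 3 * s + 2" | s where "i = 3 * s + 3" | s where "i = 3 * s + 4"
    proof (elim disjE)
      assume "i mod 3 = 0"
      hence "i = 3 * (i div 3 - 1) + 3" using i(1) by presburger
      thus ?thesis by (rule that(2))
    next
      assume "i mod 3 = 1"
      hence "i = 3 * (i div 3 - 1) + 4" using i(1) by presburger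
      thus ?thesis by (rule that(3))
    next
      assume "i mod 3 = 2"
      hence "i = 3 * (i div 3) + 2" by presburger
      thus ?thesis by (rule that(1))
    qed
    thus ?thesis
    proof cases
      case (1 s)
      hence "{i, i + 1} = {3 * s + 3, 3 * s + 2}" "s < k" using i by auto
      thus ?thesis using R2(2)[of s] by simp
    next
      case (2 s)
      hence "{i, i + 1} = {3 * s + 3, 3 * s + 4}" "s < k" using i by auto
      thus ?thesis using R2(1)[of s] by simp
    next
      case (3 s)
      hence "{i, i + 1} = {3 * s + 4, 3 * (s + 1) + 2}" "s < k" using i by auto
      thus ?thesis using R3[of s "s + 1"] by simp
    qed
  qed
  have cycle: "{1, 2} \<in> ?R" "{2, 3} \<in> ?R" "{3, 4} \<in> ?R" "{4, 5} \<in> ?R" "{5, 1} \<in> ?R"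
  proof -
    have "{1, 3 * 0 + 2} \<in> ?R" "{3 * 0 + 3, 3 * 0 + 2} \<in> ?R" "{3 * 0 + 3, 3 * 0 + 4} \<in> ?R"
      "{3 * 0 + 4, 3 * 1 + 2} \<in> ?R" "{1, 3 * 1 + 2} \<in> ?R"
      by (rule R1[of 0] R1[of 1] R2[of 0] R3[of 0 1]; use assms in simp)+
    moreover have "{1, 2} = {1, 3 * 0 + 2 :: nat}" "{2, 3} = {3 * 0 + 3, 3 * 0 + 2 :: nat}"
      "{3, 4} = {3 * 0 + 3, 3 * 0 + 4 :: nat}" "{4, 5} = {3 * 0 + 4, 3 * 1 + 2 :: nat}"
      "{5, 1} = {1, 3 * 1 + 2 :: nat}" by auto
    ultimately show "{1, 2} \<in> ?R" "{2, 3} \<in> ?R" "{3, 4} \<in> ?R" "{4, 5} \<in> ?R" "{5, 1} \<in> ?R"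
      by (simp_all only:)
  qed
  have chord: "{3 * s + 1, 3 * (l + 1) + 2} \<in> ?R" if "2 \<le> s" "s \<le> l" "l + 1 \<le> k" for s l
  proof -
    \<comment> \<open>Chords are indexed by the vertex 3s + 1 instead of 3s + 4, hence the shift of
      s by one.\<close>
    have "3 * s + 1 = 3 * (s - 1) + 4" using that by simp
    moreover have "{3 * (s - 1) + 4, 3 * (l + 1) + 2} \<in> ?R" by (rule R3) (use that in auto)
    ultimately show ?thesis by (simp only:)
  qed
  show "Gamma_edges k \<subseteq> ?R"
    unfolding Gamma_edges_def
  proof (intro Un_least subsetI, goal_cases)
    case (1 e) thus ?case using cycle by (elim insertE emptyE) (simp_all only:)
  next
    case (2 e) thus ?case using path by (elim CollectE exE conjE) (simp only:)
  next
    case (3 e) thus ?case using R1 by (elim CollectE exE conjE) (simp only:)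
  next
    case (4 e)
    then obtain t where t: "2 \<le> t" "t \<le> k" "e = {4, 3 * t + 2}" by (elim CollectE exE conjE)
    have "{3 * 0 + 4, 3 * t + 2} \<in> ?R" by (rule R3) (use t in auto)
    thus ?case by (simp only: t mult_0_right add_0)
  next
    case (5 e) thus ?case using chord by (elim CollectE exE conjE) (simp only:)
  qed
next
  let ?G = "Gamma_edges k"
  have G1: "{1, 2} \<in> ?G" "{2, 3} \<in> ?G" "{3, 4} \<in> ?G" "{4, 5} \<in> ?G" "{5, 1} \<in> ?G"
    unfolding Gamma_edges_def by (rule UnI1, rule UnI1, rule UnI1, rule UnI1, simp)+
  have G2: "{i, i + 1} \<in> ?G" if "5 \<le> i" "i \<le> 3 * k + 1" for i
    unfolding Gamma_edges_def by (rule UnI1, rule UnI1, rule UnI1, rule UnI2) (use that in blast)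
  have G3: "{1, 3 * t + 2} \<in> ?G" if "2 \<le> t" "t \<le> k" for t
    unfolding Gamma_edges_def by (rule UnI1, rule UnI1, rule UnI2) (use that in blast)
  have G3': "{4, 3 * t + 2} \<in> ?G" if "2 \<le> t" "t \<le> k" for t
    unfolding Gamma_edges_def by (rule UnI1, rule UnI2) (use that in blast)
  have G4: "{3 * s + 1, 3 * (l + 1) + 2} \<in> ?G" if "2 \<le> s" "s \<le> l" "l + 1 \<le> k" for s l
    unfolding Gamma_edges_def by (rule UnI2) (use that in blast)
  have H1: "{1, 3 * t + 2} \<in> ?G" if "t \<le> k" for t
  proof -
    consider "t = 0" | "t = 1" | "t \<ge> 2" by linarith
    thus ?thesis
    proof cases
      case 1
      hence "3 * t + 2 = 2" by simp
      thus ?thesis using G1(1) by (simp only:)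
    next
      case 2
      hence "3 * t + 2 = 5" by simp
      thus ?thesis using G1(5) by (simp only: insert_commute)
    next
      case 3 thus ?thesis using that G3 by simp
    qed
  qed
  have H2: "{3 * s + 3, 3 * s + 4} \<in> ?G" if "s < k" for s
    using that G1(3) G2[of "3 * s + 3"] by (cases "s = 0") (simp_all add: add.commute)
  have H3: "{3 * s + 3, 3 * s + 2} \<in> ?G" if "s < k" for s
  proof (cases "s = 0")
    case True
    hence "{3 * s + 3, 3 * s + 2} = {2, 3}" by auto
    thus ?thesis using G1(2) by (simp only:)
  next
    case False
    have "{3 * s + 3, 3 * s + 2} = {3 * s + 2, (3 * s + 2) + 1}" by auto
    moreover have "{3 * s + 2, (3 * s + 2) + 1} \<in> ?G" by (rule G2) (use that False in auto)
    ultimately show ?thesis by (simp only:)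
  qed
  have H4: "{3 * s + 4, 3 * t + 2} \<in> ?G" if "s < t" "t \<le> k" for s t
  proof -
    have "s = 0 \<and> t = 1 \<or> s = 0 \<and> t \<ge> 2 \<or> s \<ge> 1 \<and> t = s + 1 \<or> s \<ge> 1 \<and> t \<ge> s + 2"
      using that by arith
    then consider "s = 0" "t = 1" | "s = 0" "t \<ge> 2" | "s \<ge> 1" "t = s + 1" | "s \<ge> 1" "t \<ge> s + 2"
      by blast
    thus ?thesis
    proof cases
      case 1 thus ?thesis using G1(4) by simp
    next
      case 2 thus ?thesis using that G3'[of t] by simp
    next
      case 3 thus ?thesis using that G2[of "3 * s + 4"] by simp
    next
      case 4
      have "3 * s + 4 = 3 * (s + 1) + 1" "3 * t + 2 = 3 * ((t - 1) + 1) + 2" using 4 by simp_all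
      moreover have "{3 * (s + 1) + 1, 3 * ((t - 1) + 1) + 2} \<in> ?G"
        by (rule G4) (use that 4 in auto)
      ultimately show ?thesis by (simp only:)
    qed
  qed
  show "?R \<subseteq> ?G"
  proof (intro Un_least subsetI, goal_cases)
    case (1 e) thus ?case using H1 by (elim CollectE exE conjE imageE) (simp only: atMost_iff)
  next
    case (2 e) thus ?case using H2 H3
      by (elim CollectE exE conjE insertE emptyE) (simp_all only: lessThan_iff)
  next
    case (3 e) thus ?case using H4
      by (elim CollectE exE conjE imageE) (simp only: atLeastAtMost_iff Suc_le_eq)
  qed
qed

text \<open>\<open>S\<close> is meant for the tail sums. As \<open>a s + S (Suc s)\<close> is again
  \<open>S s\<close>, the factor (q)_(S_s) meets the denominator (q)_(S_s + 1) of leg s and leaves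
  1/(1 - q^(S_s + 1)), while (q)_(S_(s+1)) is handed on to the next leg. The initial (q)_(S_0) comes
  from vertex 1.\<close>

lemma Gamma_summand_telescope:
  fixes a :: "nat \<Rightarrow> nat"
  assumes S: "\<And>s. s < m \<Longrightarrow> S s = a s + S (Suc s)"
  shows "(\<Prod>t<m. inverse (qpoch (a t))) * qpoch (S 0) *
      (\<Prod>s<m. qpoch (a s) * qpoch (S (Suc s)) * inverse (qpoch (Suc (a s + S (Suc s)))))
    = qpoch (S m) * (\<Prod>s<m. qgeom (Suc (S s)))"
  using S
proof (induction m)
  case (Suc m)
  let ?I = "\<lambda>n. \<Prod>t<n. inverse (qpoch (a t))"
  let ?P = "\<lambda>n. \<Prod>s<n. qpoch (a s) * qpoch (S (Suc s)) * inverse (qpoch (Suc (a s + S (Suc s))))"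
  have "?I (Suc m) * qpoch (S 0) * ?P (Suc m)
     = (?I m * qpoch (S 0) * ?P m) * (qpoch (a m) * inverse (qpoch (a m))) *
       (qpoch (S (Suc m)) * inverse (qpoch (Suc (S m))))"
    unfolding prod.lessThan_Suc Suc.prems[OF lessI] by (simp only: mult_ac)
  also have "?I m * qpoch (S 0) * ?P m = qpoch (S m) * (\<Prod>s<m. qgeom (Suc (S s)))"
    by (rule Suc.IH) (use Suc.prems in simp)
  also have "qpoch (S m) * (\<Prod>s<m. qgeom (Suc (S s))) * (qpoch (a m) * inverse (qpoch (a m))) *
       (qpoch (S (Suc m)) * inverse (qpoch (Suc (S m))))
     = qpoch (S (Suc m)) * (\<Prod>s<m. qgeom (Suc (S s))) * (qpoch (S m) * inverse (qpoch (Suc (S m))))"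
    unfolding qpoch_inverse by (simp only: mult_ac mult_1_left mult_1_right)
  finally show ?case unfolding qpoch_mult_inverse_Suc by (simp only: prod.lessThan_Suc mult_ac)
qed simp

lemma graph_series_Gamma:
  assumes "k \<ge> 1"
  defines "A \<equiv> (\<lambda>t. 3 * t + 2) ` {..k}"
  shows "graph_series (3 * k + 2) (Gamma_edges k) = inverse qpoch_inf ^ Suc k *
     infsum (\<lambda>a. fps_X ^ (\<Sum>i\<in>A. a i) *
       (\<Prod>s<k. qgeom (Suc (\<Sum>j\<in>(\<lambda>t. 3 * t + 2) ` {s..k}. a j)))) (A \<rightarrow>\<^sub>E UNIV)"
proof -
  define h where "h = (\<lambda>t::nat. 3 * t + 2)"
  have inj: "inj_on h I" for I by (auto simp: h_def inj_on_def)
  have V: "{1..3 * k + 2} = A \<union> ((\<lambda>s. 3 * s + 4) ` {..<k} \<union> insert 1 ((\<lambda>s. 3 * s + 3) ` {..<k}))"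
  proof (intro equalityI subsetI)
    fix i assume i: "i \<in> {1..3 * k + 2}"
    have "i mod 3 = 0 \<or> i mod 3 = 1 \<or> i mod 3 = 2" by auto
    then consider "i = 1" | s where "i = 3 * s + 2" | s where "i = 3 * s + 3" | s where "i = 3 * s + 4"
    proof (elim disjE)
      assume "i mod 3 = 0"
      moreover have "i \<ge> 1" using i by simp
      ultimately have "i = 3 * (i div 3 - 1) + 3" by presburger
      thus ?thesis by (rule that(3))
    next
      assume "i mod 3 = 1"
      hence "i = 1 \<or> i = 3 * (i div 3 - 1) + 4" by presburger
      thus ?thesis using that(1,4) by blast
    next
      assume "i mod 3 = 2"
      hence "i = 3 * (i div 3) + 2" by presburger
      thus ?thesis by (rule that(2))
    qed
    thus "i \<in> A \<union> ((\<lambda>s. 3 * s + 4) ` {..<k} \<union> insert 1 ((\<lambda>s. 3 * s + 3) ` {..<k}))"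
      unfolding A_def by cases (use i in auto)
  qed (auto simp: A_def)
  have disj: "3 * s + 2 \<noteq> 3 * t + 4" "3 * s + 2 \<noteq> 3 * t + 3" "3 * s + 4 \<noteq> 3 * t + 3" for s t :: nat
    by presburger+
  have "graph_series (3 * k + 2) (Gamma_edges k) = inverse qpoch_inf ^ Suc (card {..<k}) *
    infsum (\<lambda>a. fps_X ^ (\<Sum>i\<in>A. a i) * (\<Prod>i\<in>A. inverse (qpoch (a i))) * qpoch (\<Sum>i\<in>A. a i) *
      (\<Prod>s<k. qpoch (\<Sum>j\<in>{3 * s + 2}. a j) * qpoch (\<Sum>j\<in>(\<lambda>t. 3 * t + 2) ` {Suc s..k}. a j) *
        inverse (qpoch (Suc ((\<Sum>j\<in>{3 * s + 2}. a j) + (\<Sum>j\<in>(\<lambda>t. 3 * t + 2) ` {Suc s..k}. a j))))))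
        (A \<rightarrow>\<^sub>E UNIV)"
  proof (rule graph_series_legs[OF V])
    show "Gamma_edges k = {{1, j} | j. j \<in> A}
     \<union> {{3 * s + 3, j} | s j. s \<in> {..<k} \<and> j \<in> insert (3 * s + 4) {3 * s + 2}}
     \<union> {{3 * s + 4, j} | s j. s \<in> {..<k} \<and> j \<in> (\<lambda>t. 3 * t + 2) ` {Suc s..k}}"
      unfolding A_def by (rule Gamma_edges_eq[OF assms(1)])
  qed (auto simp: A_def inj_on_def disj disj[symmetric], presburger+)
  also have "\<dots> = inverse qpoch_inf ^ Suc k * infsum (\<lambda>a. fps_X ^ (\<Sum>i\<in>A. a i) *
       (\<Prod>s<k. qgeom (Suc (\<Sum>j\<in>h ` {s..k}. a j)))) (A \<rightarrow>\<^sub>E UNIV)"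
    unfolding card_lessThan
  proof (rule arg_cong[where f = "\<lambda>x. _ * x"], rule infsum_cong)
    fix a :: "nat \<Rightarrow> nat"
    define S where "S s = (\<Sum>j\<in>h ` {s..k}. a j)" for s
    have S: "S s = a (h s) + S (Suc s)" if "s < k" for s
      using that by (simp add: S_def sum.reindex[OF inj] sum.atLeast_Suc_atMost)
    \<comment> \<open>The last tail sum is a single variable, so the factor (q)_(S_k) left by the
      telescoping cancels the remaining denominator from \<open>A\<close>.\<close>
    have Sk: "S k = a (h k)" by (simp add: S_def)
    have SA: "(\<Sum>i\<in>A. a i) = S 0" by (simp add: A_def S_def h_def atLeast0AtMost)
    have prodA: "(\<Prod>i\<in>A. inverse (qpoch (a i))) = (\<Prod>t<k. inverse (qpoch (a (h t)))) * inverse (qpoch (S k))"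
    proof -
      have "{..k} = insert k {..<k}" by auto
      thus ?thesis unfolding A_def h_def[symmetric] Sk prod.reindex[OF inj] o_def by (simp add: mult.commute)
    qed
    have "fps_X ^ (\<Sum>i\<in>A. a i) * (\<Prod>i\<in>A. inverse (qpoch (a i))) * qpoch (\<Sum>i\<in>A. a i) *
      (\<Prod>s<k. qpoch (a (h s)) * qpoch (S (Suc s)) * inverse (qpoch (Suc (a (h s) + S (Suc s)))))
      = fps_X ^ S 0 * inverse (qpoch (S k)) * ((\<Prod>t<k. inverse (qpoch (a (h t)))) * qpoch (S 0) *
      (\<Prod>s<k. qpoch (a (h s)) * qpoch (S (Suc s)) * inverse (qpoch (Suc (a (h s) + S (Suc s))))))"
      unfolding SA prodA by (simp only: mult_ac)
    also have "\<dots> = fps_X ^ S 0 * inverse (qpoch (S k)) * (qpoch (S k) * (\<Prod>s<k. qgeom (Suc (S s))))"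
      by (subst Gamma_summand_telescope) (simp_all add: S)
    also have "\<dots> = fps_X ^ S 0 * (qpoch (S k) * inverse (qpoch (S k))) * (\<Prod>s<k. qgeom (Suc (S s)))"
      by (simp only: mult_ac)
    finally show "fps_X ^ (\<Sum>i\<in>A. a i) * (\<Prod>i\<in>A. inverse (qpoch (a i))) * qpoch (\<Sum>i\<in>A. a i) *
      (\<Prod>s<k. qpoch (\<Sum>j\<in>{3 * s + 2}. a j) * qpoch (\<Sum>j\<in>(\<lambda>t. 3 * t + 2) ` {Suc s..k}. a j) *
        inverse (qpoch (Suc ((\<Sum>j\<in>{3 * s + 2}. a j) + (\<Sum>j\<in>(\<lambda>t. 3 * t + 2) ` {Suc s..k}. a j)))))
      = fps_X ^ (\<Sum>i\<in>A. a i) * (\<Prod>s<k. qgeom (Suc (\<Sum>j\<in>h ` {s..k}. a j)))"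
      by (simp add: SA S_def[symmetric] qpoch_inverse h_def[symmetric])
        (simp add: S_def h_def)
  qed
  finally show ?thesis by (simp only: h_def)
qed


section \<open>Geometric expansion and sums over chains\<close>

lemma infsum_prod_geometric:
  assumes "finite I"
  shows "infsum (\<lambda>f. x * (\<Prod>i\<in>I. fps_X ^ (f i * Suc (N i)))) (I \<rightarrow>\<^sub>E UNIV)
      = x * (\<Prod>i\<in>I. qgeom (Suc (N i)))"
proof -
  have "coeff_finite (\<lambda>v. fps_X ^ (v * Suc n)) UNIV" for n
    using coeff_finite_power_nat[of "Suc n" "\<lambda>_. 1"] by simp
  note P = coeff_finite_prod_PiE[of I "\<lambda>i v. fps_X ^ (v * Suc (N i))" UNIV, OF assms this]
  show ?thesis
    by (simp only: infsum_fps_cmult[OF P(1)] P(2) infsum_geometric[OF zero_less_Suc])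
qed

text \<open>
  Expanding each factor \<open>1 / (1 - q\<^sup>j)\<close> into a geometric series and summing over the original
  variables instead transposes the incidence relation between the variables and the factors.
\<close>

lemma infsum_qgeom_transpose:
  fixes A :: "'a set" and K :: "'b set"
  assumes fin: "finite A" "finite K" and R: "\<And>s. s \<in> K \<Longrightarrow> R s \<subseteq> A"
  shows "infsum (\<lambda>a. fps_X ^ (\<Sum>i\<in>A. a i) * (\<Prod>s\<in>K. qgeom (Suc (\<Sum>i\<in>R s. a i)))) (A \<rightarrow>\<^sub>E UNIV)
    = infsum (\<lambda>e. fps_X ^ (\<Sum>s\<in>K. e s) * (\<Prod>i\<in>A. qgeom (Suc (\<Sum>s | s \<in> K \<and> i \<in> R s. e s))))
        (K \<rightarrow>\<^sub>E UNIV)"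
proof -
  \<comment> \<open>The joint exponent after expansion, \<open>e s\<close> being the index of the
    geometric series for factor s. Its bilinear part has one term e_s a_i for each incident pair and
    can be grouped either way.\<close>
  define m where "m a e = (\<Sum>i\<in>A. a i) + (\<Sum>s\<in>K. e s * Suc (\<Sum>i\<in>R s. a i))" for a :: "'a \<Rightarrow> nat" and e :: "'b \<Rightarrow> nat"
  have m: "m a e = (\<Sum>s\<in>K. e s) + (\<Sum>i\<in>A. a i * Suc (\<Sum>s | s \<in> K \<and> i \<in> R s. e s))" for a e
  proof -
    have "(\<Sum>s\<in>K. e s * (\<Sum>i\<in>R s. a i)) = (\<Sum>s\<in>K. \<Sum>i | i \<in> A \<and> i \<in> R s. e s * a i)"
      by (intro sum.cong refl, subst sum_distrib_left, rule sum.cong) (use R in auto)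
    also have "\<dots> = (\<Sum>i\<in>A. \<Sum>s | s \<in> K \<and> i \<in> R s. e s * a i)"
      by (rule sum.swap_restrict) (use fin in auto)
    also have "\<dots> = (\<Sum>i\<in>A. a i * (\<Sum>s | s \<in> K \<and> i \<in> R s. e s))"
      by (simp only: sum_distrib_left mult.commute)
    finally show ?thesis by (simp add: m_def sum.distrib)
  qed
  have fin2: "coeff_finite (\<lambda>(a, e). fps_X ^ m a e) ((A \<rightarrow>\<^sub>E UNIV) \<times> (K \<rightarrow>\<^sub>E UNIV))"
  proof -
    have "coeff_finite (\<lambda>p. fps_X ^ (case p of (a, e) \<Rightarrow> m a e) * 1) ((A \<rightarrow>\<^sub>E UNIV) \<times> (K \<rightarrow>\<^sub>E UNIV))"
    proof (rule coeff_finite_X_power)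
      fix N
      have "{p \<in> (A \<rightarrow>\<^sub>E UNIV) \<times> (K \<rightarrow>\<^sub>E UNIV). (case p of (a, e) \<Rightarrow> m a e) \<le> N}
        \<subseteq> {a \<in> A \<rightarrow>\<^sub>E UNIV. (\<Sum>i\<in>A. a i) \<le> N} \<times> {e \<in> K \<rightarrow>\<^sub>E UNIV. (\<Sum>s\<in>K. e s) \<le> N}"
      proof -
        have le: "(\<Sum>i\<in>A. a i) \<le> m a e" "(\<Sum>s\<in>K. e s) \<le> m a e" for a e
          by (simp add: m_def, simp add: m)
        show ?thesis
        proof (intro subsetI, elim CollectE conjE SigmaE, hypsubst, unfold prod.case)
          fix a e assume "a \<in> A \<rightarrow>\<^sub>E UNIV" "e \<in> K \<rightarrow>\<^sub>E UNIV" "m a e \<le> N"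
          thus "(a, e) \<in> {a \<in> A \<rightarrow>\<^sub>E UNIV. (\<Sum>i\<in>A. a i) \<le> N} \<times> {e \<in> K \<rightarrow>\<^sub>E UNIV. (\<Sum>s\<in>K. e s) \<le> N}"
            using le_trans[OF le(1)[of a e]] le_trans[OF le(2)[of e a]] by simp
        qed
      qed
      thus "finite {p \<in> (A \<rightarrow>\<^sub>E UNIV) \<times> (K \<rightarrow>\<^sub>E UNIV). (case p of (a, e) \<Rightarrow> m a e) \<le> N}"
        by (rule finite_subset) (intro finite_cartesian_product finite_PiE_sum_le fin)
    qed
    thus ?thesis by (simp add: case_prod_unfold)
  qed
  have "infsum (\<lambda>a. fps_X ^ (\<Sum>i\<in>A. a i) * (\<Prod>s\<in>K. qgeom (Suc (\<Sum>i\<in>R s. a i)))) (A \<rightarrow>\<^sub>E UNIV)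
     = infsum (\<lambda>a. infsum (\<lambda>e. fps_X ^ m a e) (K \<rightarrow>\<^sub>E UNIV)) (A \<rightarrow>\<^sub>E UNIV)"
    by (simp only: m_def power_add power_sum infsum_prod_geometric[OF fin(2)])
  also have "\<dots> = infsum (\<lambda>e. infsum (\<lambda>a. fps_X ^ m a e) (A \<rightarrow>\<^sub>E UNIV)) (K \<rightarrow>\<^sub>E UNIV)"
    by (rule infsum_fps_swap[OF fin2])
  also have "\<dots> = infsum (\<lambda>e. fps_X ^ (\<Sum>s\<in>K. e s) * (\<Prod>i\<in>A. qgeom (Suc (\<Sum>s | s \<in> K \<and> i \<in> R s. e s))))
        (K \<rightarrow>\<^sub>E UNIV)"
    by (simp only: m power_add power_sum infsum_prod_geometric[OF fin(1)])
  finally show ?thesis .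
qed

text \<open>Substitution n = m + v on the triangle m \<le> n. Extension by zero to the full square
  reduces it to \<open>infsum_fps_swap\<close>, and q^n bounds both indices.\<close>

lemma infsum_triangle:
  fixes c :: "nat \<Rightarrow> nat \<Rightarrow> rat fps"
  shows "infsum (\<lambda>n. \<Sum>m\<le>n. fps_X ^ n * c n m) UNIV
    = infsum (\<lambda>m. infsum (\<lambda>v. fps_X ^ (m + v) * c (m + v) m) UNIV) UNIV"
proof -
  define F where "F n m = (if m \<le> n then fps_X ^ n * c n m else 0)" for n m
  have fin: "coeff_finite (\<lambda>(n, m). F n m) (UNIV \<times> UNIV)"
    unfolding coeff_finite_def
  proof
    fix N
    have "{p \<in> UNIV \<times> UNIV. fps_nth (case p of (n, m) \<Rightarrow> F n m) N \<noteq> 0} \<subseteq> {..N} \<times> {..N}"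
      by (auto simp: F_def fps_X_power_mult_nth split: if_splits)
    thus "finite {p \<in> UNIV \<times> UNIV. fps_nth (case p of (n, m) \<Rightarrow> F n m) N \<noteq> 0}"
      by (rule finite_subset) auto
  qed
  have "infsum (\<lambda>n. \<Sum>m\<le>n. fps_X ^ n * c n m) UNIV = infsum (\<lambda>n. infsum (F n) UNIV) UNIV"
  proof (rule infsum_cong)
    fix n
    have "infsum (F n) UNIV = infsum (\<lambda>m. fps_X ^ n * c n m) {..n}"
      by (rule infsum_cong_neutral) (auto simp: F_def)
    thus "(\<Sum>m\<le>n. fps_X ^ n * c n m) = infsum (F n) UNIV" by simp
  qed
  also have "\<dots> = infsum (\<lambda>m. infsum (\<lambda>n. F n m) UNIV) UNIV"
    by (rule infsum_fps_swap[OF fin])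
  also have "\<dots> = infsum (\<lambda>m. infsum (\<lambda>v. fps_X ^ (m + v) * c (m + v) m) UNIV) UNIV"
  proof (rule infsum_cong)
    fix m
    have "infsum (\<lambda>n. F n m) UNIV = infsum (\<lambda>n. fps_X ^ n * c n m) {m..}"
      by (rule infsum_cong_neutral) (auto simp: F_def)
    also have "bij_betw (\<lambda>v. m + v) UNIV {m..}"
      by (rule bij_betw_byWitness[where f' = "\<lambda>n. n - m"]) auto
    from infsum_reindex_bij_betw[OF this, of "\<lambda>n. fps_X ^ n * c n m"]
    have "infsum (\<lambda>n. fps_X ^ n * c n m) {m..} = infsum (\<lambda>v. fps_X ^ (m + v) * c (m + v) m) UNIV" ..
    finally show "infsum (\<lambda>n. F n m) UNIV = infsum (\<lambda>v. fps_X ^ (m + v) * c (m + v) m) UNIV" .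
  qed
  finally show ?thesis .
qed

text \<open>The complete homogeneous symmetric polynomial of degree \<open>j\<close> in \<open>1 / (1 - q\<^sup>i)\<close>, \<open>1 \<le> i \<le> n\<close>.\<close>

fun qhom :: "nat \<Rightarrow> nat \<Rightarrow> rat fps" where
  "qhom 0 n = 1"
| "qhom (Suc j) n = (\<Sum>i=1..n. qgeom i * qhom j i)"

text \<open>The partial sums of e form a weakly increasing chain. The last variable is summed first
  and absorbed into the weight, which is why the induction needs arbitrary \<open>g\<close>;
  \<open>infsum_triangle\<close> then makes the total the outer index, and the inner sum is the
  recursion of \<open>qhom\<close>.\<close>

lemma infsum_chain:
  "infsum (\<lambda>e. fps_X ^ (\<Sum>s<Suc k. e s) * g (\<Sum>s<Suc k. e s) * (\<Prod>t<Suc k. qgeom (Suc (\<Sum>s\<le>t. e s))))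
     ({..<Suc k} \<rightarrow>\<^sub>E UNIV)
   = infsum (\<lambda>m. fps_X ^ m * g m * qgeom (Suc m) * qhom k (Suc m)) UNIV"
proof (induction k arbitrary: g)
  case 0
  have "infsum (\<lambda>e. (\<lambda>m. fps_X ^ m * (g m * qgeom (Suc m))) (e 0)) ({0 :: nat} \<rightarrow>\<^sub>E UNIV)
      = infsum (\<lambda>m. fps_X ^ m * (g m * qgeom (Suc m))) UNIV"
    by (rule infsum_PiE_singleton, rule coeff_finite_X_power) simp
  moreover have "{..<Suc 0} = {0}" by auto
  ultimately show ?case by (simp add: mult.assoc)
next
  case (Suc k)
  define g' where "g' m = infsum (\<lambda>v. fps_X ^ v * (g (m + v) * qgeom (Suc (m + v)))) UNIV" for m
  define F where "F e = fps_X ^ (\<Sum>s<Suc (Suc k). e s) * g (\<Sum>s<Suc (Suc k). e s) *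
      (\<Prod>t<Suc (Suc k). qgeom (Suc (\<Sum>s\<le>t. e s)))" for e
  have un: "{..<Suc (Suc k)} = {..<Suc k} \<union> {Suc k}" by auto
  have finF: "coeff_finite F ({..<Suc k} \<union> {Suc k} \<rightarrow>\<^sub>E UNIV)"
    unfolding un[symmetric] F_def mult.assoc
    by (rule coeff_finite_X_power) (rule finite_PiE_sum_le, simp)
  have cf: "coeff_finite (\<lambda>v. fps_X ^ v * G v) UNIV" for G
    by (rule coeff_finite_X_power) simp
  have "infsum F ({..<Suc (Suc k)} \<rightarrow>\<^sub>E UNIV) =
      infsum (\<lambda>e. infsum (\<lambda>f. F (\<lambda>i. if i \<in> {..<Suc k} then e i else f i)) ({Suc k} \<rightarrow>\<^sub>E UNIV))
        ({..<Suc k} \<rightarrow>\<^sub>E UNIV)"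
    unfolding un by (rule infsum_PiE_Un[OF _ finF]) auto
  also have "\<dots> = infsum (\<lambda>e. fps_X ^ (\<Sum>s<Suc k. e s) * g' (\<Sum>s<Suc k. e s) *
      (\<Prod>t<Suc k. qgeom (Suc (\<Sum>s\<le>t. e s)))) ({..<Suc k} \<rightarrow>\<^sub>E UNIV)"
  proof (rule infsum_cong)
    fix e :: "nat \<Rightarrow> nat"
    define M where "M = (\<Sum>s<Suc k. e s)"
    define W where "W = (\<Prod>t<Suc k. qgeom (Suc (\<Sum>s\<le>t. e s)))"
    define H where "H v = fps_X ^ v * (g (M + v) * qgeom (Suc (M + v)))" for v
    have "F (\<lambda>i. if i \<in> {..<Suc k} then e i else f i) = fps_X ^ M * W * H (f (Suc k))" for f
    proof -
      let ?n = "\<lambda>i. if i \<in> {..<Suc k} then e i else f i"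
      have 1: "(\<Sum>s<Suc (Suc k). ?n s) = M + f (Suc k)"
        by (simp only: sum.lessThan_Suc[of _ "Suc k"]) (simp add: M_def)
      have 2: "(\<Sum>s\<le>Suc k. ?n s) = M + f (Suc k)"
        using 1 by (simp only: lessThan_Suc_atMost)
      have 3: "(\<Prod>t<Suc k. qgeom (Suc (\<Sum>s\<le>t. ?n s))) = W"
        unfolding W_def
      proof (rule prod.cong[OF refl])
        fix t assume "t \<in> {..<Suc k}"
        hence "(\<Sum>s\<le>t. ?n s) = (\<Sum>s\<le>t. e s)" by (intro sum.cong) auto
        thus "qgeom (Suc (\<Sum>s\<le>t. ?n s)) = qgeom (Suc (\<Sum>s\<le>t. e s))" by (simp only:)
      qed
      show ?thesis
        unfolding F_def 1 prod.lessThan_Suc[of _ "Suc k"] 2 3 H_def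
        by (simp only: power_add mult_ac)
    qed
    hence "infsum (\<lambda>f. F (\<lambda>i. if i \<in> {..<Suc k} then e i else f i)) ({Suc k} \<rightarrow>\<^sub>E UNIV)
      = infsum (\<lambda>f. fps_X ^ M * W * H (f (Suc k))) ({Suc k} \<rightarrow>\<^sub>E UNIV)" by (simp only:)
    also have "\<dots> = infsum (\<lambda>v. fps_X ^ M * W * H v) UNIV"
      by (rule infsum_PiE_singleton[of "\<lambda>v. fps_X ^ M * W * H v"])
         (unfold H_def, rule coeff_finite_cmult[OF cf])
    also have "\<dots> = fps_X ^ M * W * g' M"
      unfolding g'_def H_def by (rule infsum_fps_cmult[OF cf])
    finally show "infsum (\<lambda>f. F (\<lambda>i. if i \<in> {..<Suc k} then e i else f i)) ({Suc k} \<rightarrow>\<^sub>E UNIV)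
       = fps_X ^ (\<Sum>s<Suc k. e s) * g' (\<Sum>s<Suc k. e s) * (\<Prod>t<Suc k. qgeom (Suc (\<Sum>s\<le>t. e s)))"
      by (simp only: M_def W_def mult_ac)
  qed
  also have "\<dots> = infsum (\<lambda>m. fps_X ^ m * g' m * qgeom (Suc m) * qhom k (Suc m)) UNIV"
    by (rule Suc.IH)
  also have "\<dots> = infsum (\<lambda>m. infsum (\<lambda>v. fps_X ^ (m + v) *
      (g (m + v) * qgeom (Suc (m + v)) * (qgeom (Suc m) * qhom k (Suc m)))) UNIV) UNIV"
  proof (rule infsum_cong)
    fix m
    define x where "x = fps_X ^ m * (qgeom (Suc m) * qhom k (Suc m))"
    have "infsum (\<lambda>v. x * (fps_X ^ v * (g (m + v) * qgeom (Suc (m + v))))) UNIV = x * g' m"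
      unfolding g'_def by (rule infsum_fps_cmult[OF cf])
    thus "fps_X ^ m * g' m * qgeom (Suc m) * qhom k (Suc m) = infsum (\<lambda>v. fps_X ^ (m + v) *
      (g (m + v) * qgeom (Suc (m + v)) * (qgeom (Suc m) * qhom k (Suc m)))) UNIV"
      unfolding x_def by (simp only: power_add mult_ac)
  qed
  also have "\<dots> = infsum (\<lambda>n. \<Sum>m\<le>n. fps_X ^ n *
      (g n * qgeom (Suc n) * (qgeom (Suc m) * qhom k (Suc m)))) UNIV"
    by (rule infsum_triangle[symmetric])
  also have "\<dots> = infsum (\<lambda>n. fps_X ^ n * g n * qgeom (Suc n) * qhom (Suc k) (Suc n)) UNIV"
  proof (rule infsum_cong)
    fix n
    have "qhom (Suc k) (Suc n) = (\<Sum>m\<le>n. qgeom (Suc m) * qhom k (Suc m))"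
      by (simp only: qhom.simps sum.atLeast_Suc_atMost_Suc_shift One_nat_def o_def atLeast0AtMost)
    thus "(\<Sum>m\<le>n. fps_X ^ n * (g n * qgeom (Suc n) * (qgeom (Suc m) * qhom k (Suc m))))
        = fps_X ^ n * g n * qgeom (Suc n) * qhom (Suc k) (Suc n)"
      by (simp only: sum_distrib_left mult.assoc)
  qed
  finally show ?case unfolding F_def[abs_def] .
qed

lemma graph_series_Gamma_chain:
  "graph_series (3 * Suc k + 2) (Gamma_edges (Suc k)) = inverse qpoch_inf ^ Suc (Suc k) *
     infsum (\<lambda>m. fps_X ^ m * qgeom (Suc m) ^ 2 * qhom k (Suc m)) UNIV"
proof -
  define h where "h = (\<lambda>t::nat. 3 * t + 2)"
  have inj: "inj_on h I" for I by (auto simp: h_def inj_on_def)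
  have "infsum (\<lambda>a. fps_X ^ (\<Sum>i\<in>h ` {..Suc k}. a i) *
       (\<Prod>s<Suc k. qgeom (Suc (\<Sum>j\<in>h ` {s..Suc k}. a j)))) (h ` {..Suc k} \<rightarrow>\<^sub>E UNIV)
    = infsum (\<lambda>e. fps_X ^ (\<Sum>s<Suc k. e s) * (\<Prod>i\<in>h ` {..Suc k}.
         qgeom (Suc (\<Sum>s | s \<in> {..<Suc k} \<and> i \<in> h ` {s..Suc k}. e s)))) ({..<Suc k} \<rightarrow>\<^sub>E UNIV)"
    by (rule infsum_qgeom_transpose) auto
  also have "\<dots> = infsum (\<lambda>e. fps_X ^ (\<Sum>s<Suc k. e s) * qgeom (Suc (\<Sum>s<Suc k. e s)) *
      (\<Prod>t<Suc k. qgeom (Suc (\<Sum>s\<le>t. e s)))) ({..<Suc k} \<rightarrow>\<^sub>E UNIV)"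
  proof (rule infsum_cong)
    fix e :: "nat \<Rightarrow> nat"
    have "{s. s \<in> {..<Suc k} \<and> h t \<in> h ` {s..Suc k}} = {s. s < Suc k \<and> s \<le> t}" if "t \<le> Suc k" for t
      using that inj_image_mem_iff[OF inj] by auto
    hence "(\<Prod>i\<in>h ` {..Suc k}. qgeom (Suc (\<Sum>s | s \<in> {..<Suc k} \<and> i \<in> h ` {s..Suc k}. e s)))
      = (\<Prod>t\<le>Suc k. qgeom (Suc (\<Sum>s | s < Suc k \<and> s \<le> t. e s)))"
      unfolding prod.reindex[OF inj] o_def by (intro prod.cong) auto
    also have "\<dots> = (\<Prod>t<Suc k. qgeom (Suc (\<Sum>s | s < Suc k \<and> s \<le> t. e s))) *
        qgeom (Suc (\<Sum>s | s < Suc k \<and> s \<le> Suc k. e s))"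
      by (simp only: lessThan_Suc_atMost[symmetric] prod.lessThan_Suc)
    \<comment> \<open>For t = \<open>Suc k\<close> the bound s \<le> t is vacuous, so this factor
      repeats the one for t = k: the origin of the square of \<open>qgeom (Suc m)\<close>.\<close>
    also have "{s. s < Suc k \<and> s \<le> Suc k} = {..<Suc k}" by auto
    also have "(\<Prod>t<Suc k. qgeom (Suc (\<Sum>s | s < Suc k \<and> s \<le> t. e s)))
        = (\<Prod>t<Suc k. qgeom (Suc (\<Sum>s\<le>t. e s)))"
    proof (rule prod.cong[OF refl])
      fix t assume "t \<in> {..<Suc k}"
      hence "{s. s < Suc k \<and> s \<le> t} = {..t}" by auto
      thus "qgeom (Suc (\<Sum>s | s < Suc k \<and> s \<le> t. e s)) = qgeom (Suc (\<Sum>s\<le>t. e s))" by (simp only:)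
    qed
    finally show "fps_X ^ (\<Sum>s<Suc k. e s) * (\<Prod>i\<in>h ` {..Suc k}.
         qgeom (Suc (\<Sum>s | s \<in> {..<Suc k} \<and> i \<in> h ` {s..Suc k}. e s)))
       = fps_X ^ (\<Sum>s<Suc k. e s) * qgeom (Suc (\<Sum>s<Suc k. e s)) *
      (\<Prod>t<Suc k. qgeom (Suc (\<Sum>s\<le>t. e s)))" by (simp only: mult_ac)
  qed
  also have "\<dots> = infsum (\<lambda>m. fps_X ^ m * qgeom (Suc m) ^ 2 * qhom k (Suc m)) UNIV"
    using infsum_chain[of k "\<lambda>m. qgeom (Suc m)"] by (simp only: power2_eq_square mult.assoc)
  finally show ?thesis
    using graph_series_Gamma[of "Suc k"] by (simp only: h_def)
qed


subsection \<open>Evaluation of the nested sum\<close>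

text \<open>
  Power series in an auxiliary variable over \<open>\<rat>[[q]]\<close> collect the polynomials \<open>qhom d n\<close> for all
  \<open>d\<close>; \<open>qlin j\<close> is \<open>1 - x - q\<^sup>j\<close> and \<open>qlin_inv j\<close> its inverse.
\<close>

definition qlin :: "nat \<Rightarrow> rat fps fps" where
  "qlin j = 1 - fps_X - fps_const (fps_X ^ j)"

definition qlin_inv :: "nat \<Rightarrow> rat fps fps" where
  "qlin_inv j = Abs_fps (\<lambda>d. qgeom j ^ Suc d)"

lemma qlin_mult_inv:
  assumes "0 < j"
  shows "qlin j * qlin_inv j = 1"
proof (rule fps_ext)
  fix d
  have "qlin j = fps_const (1 - fps_X ^ j) - fps_X"
    by (simp add: qlin_def flip: fps_const_sub)
  hence "fps_nth (qlin j * qlin_inv j) d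
      = (1 - fps_X ^ j) * qgeom j * qgeom j ^ d - (if d = 0 then 0 else qgeom j ^ d)"
    by (simp add: left_diff_distrib qlin_inv_def mult.assoc flip: power_Suc)
  thus "fps_nth (qlin j * qlin_inv j) d = fps_nth 1 d"
    using qgeom_mult[OF assms] by simp
qed

text \<open>The shift i = 0 is the one related to \<open>qhom\<close>; the general shift is the
  additional parameter along which the sum telescopes.\<close>

definition qlin_prod :: "nat \<Rightarrow> nat \<Rightarrow> rat fps fps" where
  "qlin_prod i m = (\<Prod>j=1..m. qlin_inv (i + j))"

lemma qlin_prod_Suc: "qlin_prod i (Suc m) = qlin_prod i m * qlin_inv (i + Suc m)"
  by (simp add: qlin_prod_def)

lemma qlin_prod_Suc_last: "qlin_prod i m = qlin_prod i (Suc m) * qlin (i + Suc m)"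
  using qlin_mult_inv[of "i + Suc m"] by (simp add: qlin_prod_Suc mult.assoc mult.commute)

lemma qlin_prod_Suc_first: "qlin_prod (Suc i) m = qlin_prod i (Suc m) * qlin (Suc i)"
proof -
  have "qlin_prod i (Suc m) = qlin_inv (Suc i) * qlin_prod (Suc i) m"
    unfolding qlin_prod_def
    by (subst prod.atLeast_Suc_atMost) (simp_all only: prod.atLeast_Suc_atMost_Suc_shift, simp_all)
  thus ?thesis using qlin_mult_inv[of "Suc i"] by (simp add: mult_ac)
qed

text \<open>With w_j = 1/(1 - q^j), the complete homogeneous polynomials have generating function
  the product of 1/(1 - w_j x), and (1 - q^j)(1 - w_j x) is \<open>qlin j\<close>; the factors 1 -
  q^j make up (q)_m.\<close>

lemma qlin_prod_0_qhom: "fps_const (qpoch m) * qlin_prod 0 m = Abs_fps (\<lambda>d. qhom d m)"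
proof (induction m)
  case 0
  have "qhom d 0 = (if d = 0 then 1 else 0)" for d by (cases d) auto
  thus ?case by (simp add: qlin_prod_def fps_eq_iff)
next
  case (Suc m)
  let ?H = "\<lambda>m. Abs_fps (\<lambda>d. qhom d m)"
  let ?w = "qgeom (Suc m)"
  \<comment> \<open>This is h_d(m+1) = h_d(m) + w h_(d-1)(m+1) with w = 1/(1 - q^(m+1)).\<close>
  have H: "?H m = ?H (Suc m) * (1 - fps_const ?w * fps_X)"
  proof (rule fps_ext)
    fix d
    show "fps_nth (?H m) d = fps_nth (?H (Suc m) * (1 - fps_const ?w * fps_X)) d"
      by (cases d) (simp_all add: right_diff_distrib mult.left_commute[of _ "fps_const _"])
  qed
  have lin: "fps_const (1 - fps_X ^ Suc m) * (1 - fps_const ?w * fps_X) = qlin (Suc m)"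
  proof -
    have "fps_const (1 - fps_X ^ Suc m) * fps_const ?w = (1 :: rat fps fps)"
      using qgeom_mult[of "Suc m"] by (simp del: power_Suc)
    thus ?thesis
      by (simp add: qlin_def right_diff_distrib mult.assoc[symmetric] del: power_Suc flip: fps_const_sub)
  qed
  have "fps_const (qpoch (Suc m)) * qlin_prod 0 (Suc m)
      = (fps_const (qpoch m) * qlin_prod 0 m) * fps_const (1 - fps_X ^ Suc m) * qlin_inv (Suc m)"
    unfolding qpoch_Suc qlin_prod_Suc fps_const_mult[symmetric] add_0 by (simp only: mult_ac)
  also have "\<dots> = ?H (Suc m) * (fps_const (1 - fps_X ^ Suc m) * (1 - fps_const ?w * fps_X) * qlin_inv (Suc m))"
    unfolding Suc.IH by (subst H) (simp only: mult_ac)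
  also have "\<dots> = ?H (Suc m)"
    unfolding lin qlin_mult_inv[OF zero_less_Suc] by simp
  finally show ?case .
qed

lemma qlin_prod_0_nth: "fps_nth (qlin_prod 0 m) d = inverse (qpoch m) * qhom d m"
proof -
  have "qpoch m * fps_nth (qlin_prod 0 m) d = qhom d m"
    using arg_cong[OF qlin_prod_0_qhom[of m], of "\<lambda>f. fps_nth f d"] by simp
  hence "inverse (qpoch m) * (qpoch m * fps_nth (qlin_prod 0 m) d) = inverse (qpoch m) * qhom d m"
    by simp
  thus ?thesis
    using qpoch_inverse[of m] by (simp add: mult.assoc[symmetric] mult.commute[of "inverse _"])
qed

lemma coeff_finite_X_power_Suc: "coeff_finite (\<lambda>n. fps_X ^ Suc n * G n) UNIV"
proof (rule coeff_finite_X_power)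
  fix m
  show "finite {n \<in> UNIV. Suc n \<le> m}"
    by (rule finite_subset[of _ "{..m}"]) auto
qed

section \<open>Telescoping in two parameters\<close>

text \<open>At i = 0 the coefficients of \<open>t\<close> in the auxiliary variable are the summands
  to be evaluated; \<open>u\<close> is \<open>t\<close> without the factor 1/(1 - q^(n+1)). The
  power q^((n+1)(i+1)) makes both tend to 0 as either index grows.\<close>

context
  fixes t u :: "nat \<Rightarrow> nat \<Rightarrow> rat fps fps"
  defines "t \<equiv> \<lambda>i n. fps_const (fps_X ^ (Suc n * Suc i) * (qpoch n * qgeom (Suc n))) * qlin_prod i (Suc n)"
    and "u \<equiv> \<lambda>i n. fps_const (fps_X ^ (Suc n * Suc i) * qpoch n) * qlin_prod i (Suc n)"
begin

text \<open>The two-parameter family \<open>t\<close> telescopes along both indices, with \<open>u\<close> as certificate.\<close>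

lemma qlin_prod_certificate:
  "t i n - t (Suc i) n = (1 - fps_X) * qlin_inv (Suc i) * (u i n - u i (Suc n))"
proof -
  \<comment> \<open>All four terms are multiples of the longest product \<open>Z\<close>. With y = 1
    - x, a = q^(n+1), b = q^(i+1), what remains is elementary algebra.\<close>
  define Z where "Z = qlin_prod i (Suc (Suc n))"
  define y where "y = (1 - fps_X :: rat fps fps)"
  define C where "C = fps_const (fps_X ^ (Suc n * Suc i) * qpoch n)"
  define a where "a = (fps_const (fps_X ^ Suc n) :: rat fps fps)"
  define b where "b = (fps_const (fps_X ^ Suc i) :: rat fps fps)"
  define w where "w = (fps_const (qgeom (Suc n)) :: rat fps fps)"
  have aw: "(1 - a) * w = 1"
  proof -
    have "1 - a = fps_const (1 - fps_X ^ Suc n)"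
      by (simp add: a_def flip: fps_const_sub)
    thus ?thesis
      using qgeom_mult[of "Suc n"] by (simp only: w_def fps_const_mult fps_const_1_eq_1)
  qed
  have ab: "fps_const (fps_X ^ (i + Suc (Suc n))) = a * b"
    by (simp add: a_def b_def power_add mult_ac)
  have G1: "qlin_prod i (Suc n) = Z * (y - a * b)"
    unfolding qlin_prod_Suc_last[of i "Suc n"] qlin_def Z_def y_def ab ..
  have G2: "qlin_prod (Suc i) (Suc n) = Z * (y - b)"
    unfolding qlin_prod_Suc_first[of i "Suc n"] qlin_def Z_def y_def b_def ..
  have t1: "t i n = C * w * (Z * (y - a * b))"
    unfolding t_def G1 C_def w_def fps_const_mult by (simp only: mult.assoc)
  have t2: "t (Suc i) n = C * a * w * (Z * (y - b))"
    unfolding t_def G2 C_def w_def a_def fps_const_mult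
    by (simp only: mult_Suc_right power_add mult_ac)
  have u1: "u i n = C * (Z * (y - a * b))"
    unfolding u_def G1 C_def ..
  have u2: "u i (Suc n) = C * b * (1 - a) * Z"
  proof -
    have "1 - a = fps_const (1 - fps_X ^ Suc n)"
      by (simp add: a_def flip: fps_const_sub)
    moreover have "Suc (Suc n) * Suc i = Suc n * Suc i + Suc i" by simp
    ultimately show ?thesis
      unfolding u_def Z_def C_def b_def qpoch_Suc
      by (simp only: fps_const_mult power_add mult_ac)
  qed
  \<comment> \<open>Rests on (y - ab) - a (y - b) = y (1 - a).\<close>
  have t: "t i n - t (Suc i) n = C * Z * y * ((1 - a) * w)"
    unfolding t1 t2 by (simp add: algebra_simps)
  \<comment> \<open>Rests on (y - ab) - b (1 - a) = y - b, the linear factor that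
    \<open>qlin_inv (Suc i)\<close> removes.\<close>
  have u: "u i n - u i (Suc n) = C * Z * qlin (Suc i)"
    unfolding u1 u2 qlin_def y_def[symmetric] b_def[symmetric] by (simp add: algebra_simps)
  have inv: "qlin_inv (Suc i) * (C * Z * qlin (Suc i)) = C * Z"
    using qlin_mult_inv[of "Suc i"] by (simp add: mult_ac)
  show ?thesis
    unfolding t u y_def[symmetric] mult.assoc[of y "qlin_inv (Suc i)"] inv aw
    by (simp only: mult_ac mult_1_left mult_1_right)
qed

text \<open>The prefactor in the certificate does not depend on n, so its right side telescopes in
  n; adding over i telescopes the left side.\<close>

lemma qlin_prod_double_telescope:
  "(\<Sum>n<N. t 0 n) - (\<Sum>n<N. t M n) =
     (\<Sum>i<M. (1 - fps_X) * qlin_inv (Suc i) * (u i 0 - u i N))"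
proof (induction M)
  case (Suc M)
  have "(\<Sum>n<N. t M n) - (\<Sum>n<N. t (Suc M) n)
      = (\<Sum>n<N. (1 - fps_X) * qlin_inv (Suc M) * (u M n - u M (Suc n)))"
    by (simp only: qlin_prod_certificate flip: sum_subtractf)
  also have "\<dots> = (1 - fps_X) * qlin_inv (Suc M) * (u M 0 - u M N)"
    by (simp only: sum_distrib_left[symmetric] sum_lessThan_telescope')
  finally have step: "(\<Sum>n<N. t M n) - (\<Sum>n<N. t (Suc M) n)
      = (1 - fps_X) * qlin_inv (Suc M) * (u M 0 - u M N)" .
  have "(\<Sum>n<N. t 0 n) - (\<Sum>n<N. t (Suc M) n)
      = ((\<Sum>n<N. t 0 n) - (\<Sum>n<N. t M n)) + ((\<Sum>n<N. t M n) - (\<Sum>n<N. t (Suc M) n))" by simp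
  thus ?case unfolding step Suc.IH by (simp only: sum.lessThan_Suc)
qed simp

text \<open>
  The coefficient of degree \<open>k\<close> in the double telescoping; modulo \<open>q\<^bsup>N+1\<^esup>\<close> the boundary terms
  \<open>t N n\<close> and \<open>u i N\<close> vanish.
\<close>

lemma nested_sum_eq:
  "infsum (\<lambda>n. fps_X ^ Suc n * (qgeom (Suc n) ^ 2 * qhom k (Suc n))) UNIV
   = infsum (\<lambda>i. fps_X ^ Suc i * (of_nat (Suc k) * qgeom (Suc i) ^ Suc (Suc k)
       - of_nat k * qgeom (Suc i) ^ Suc k)) UNIV" (is "infsum ?f UNIV = infsum ?g UNIV")
proof (rule fps_ext)
  fix m
  have fin: "coeff_finite (\<lambda>n. fps_X ^ Suc n * G n) UNIV" for G :: "nat \<Rightarrow> rat fps"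
    by (rule coeff_finite_X_power_Suc)
  \<comment> \<open>One bound serves for both truncations: the discarded terms carry q^((n+1)(N+1))
    or q^((N+1)(i+1)), and both exponents exceed m.\<close>
  define N where "N = Suc m"
  have nth: "fps_nth (infsum (\<lambda>n. fps_X ^ Suc n * G n) UNIV) m
      = (\<Sum>n<N. fps_nth (fps_X ^ Suc n * G n) m)" for G :: "nat \<Rightarrow> rat fps"
    by (rule infsum_fps_nth_superset[OF fin])
       (auto simp: N_def fps_X_power_mult_nth simp del: power_Suc)
  have t0: "fps_nth (t 0 n) k = ?f n" for n
  proof -
    have "fps_nth (t 0 n) k
       = fps_X ^ Suc n * (qpoch n * inverse (qpoch (Suc n)) * qgeom (Suc n) * qhom k (Suc n))"
      by (simp add: t_def qlin_prod_0_nth mult_ac del: power_Suc)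
    thus ?thesis by (simp only: qpoch_mult_inverse_Suc power2_eq_square)
  qed
  have tN: "fps_nth (fps_nth (t N n) k) m = 0" for n
  proof -
    have "m < Suc n * Suc N" by (simp add: N_def)
    thus ?thesis by (simp add: t_def mult.assoc fps_X_power_mult_nth del: mult_Suc mult_Suc_right)
  qed
  have uN: "fps_nth (fps_nth ((1 - fps_X) * qlin_inv (Suc i) * u i N) k) m = 0" for i
  proof -
    have eq: "(1 - fps_X) * qlin_inv (Suc i) * u i N = fps_const (fps_X ^ (Suc N * Suc i))
       * ((1 - fps_X) * qlin_inv (Suc i) * (fps_const (qpoch N) * qlin_prod i (Suc N)))"
      unfolding u_def fps_const_mult[symmetric] by (simp only: mult_ac)
    have "m < Suc N * Suc i" by (simp add: N_def)
    thus ?thesis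
      unfolding eq by (simp add: fps_X_power_mult_nth del: mult_Suc mult_Suc_right)
  qed
  have u0: "fps_nth ((1 - fps_X) * qlin_inv (Suc i) * u i 0) k = ?g i" for i
  proof -
    let ?w = "qgeom (Suc i)"
    \<comment> \<open>As \<open>u i 0\<close> is q^(i+1) \<open>qlin_inv (Suc i)\<close>, the square
      of a geometric series appears; multiplying it by 1 - x produces the difference (k+1) w^(k+2) -
      k w^(k+1).\<close>
    have sq: "qlin_inv (Suc i) * qlin_inv (Suc i) = Abs_fps (\<lambda>d. of_nat (Suc d) * ?w ^ Suc (Suc d))"
    proof (rule fps_ext)
      fix d
      have "fps_nth (qlin_inv (Suc i) * qlin_inv (Suc i)) d = (\<Sum>j=0..d. ?w ^ Suc j * ?w ^ Suc (d - j))"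
        by (simp add: fps_mult_nth qlin_inv_def)
      also have "\<dots> = (\<Sum>j=0..d. ?w ^ Suc (Suc d))"
        by (intro sum.cong refl) (simp flip: power_Suc power_add)
      finally show "fps_nth (qlin_inv (Suc i) * qlin_inv (Suc i)) d
          = fps_nth (Abs_fps (\<lambda>d. of_nat (Suc d) * ?w ^ Suc (Suc d))) d" by simp
    qed
    have "(1 - fps_X) * qlin_inv (Suc i) * u i 0
       = fps_const (fps_X ^ Suc i) * ((1 - fps_X) * (qlin_inv (Suc i) * qlin_inv (Suc i)))"
      by (simp add: u_def qlin_prod_def mult_ac del: power_Suc)
    thus ?thesis
      unfolding sq by (cases k) (simp_all add: left_diff_distrib del: power_Suc of_nat_Suc)
  qed
  have "fps_nth (infsum ?f UNIV) m = (\<Sum>n<N. fps_nth (fps_nth (t 0 n) k) m)"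
    unfolding t0 by (rule nth)
  also have "\<dots> = fps_nth (fps_nth ((\<Sum>n<N. t 0 n) - (\<Sum>n<N. t N n)) k) m"
    by (simp add: fps_sum_nth tN)
  also have "\<dots> = (\<Sum>i<N. fps_nth (fps_nth ((1 - fps_X) * qlin_inv (Suc i) * u i 0) k) m)"
    unfolding qlin_prod_double_telescope right_diff_distrib sum_subtractf
    by (simp add: fps_sum_nth uN)
  also have "\<dots> = fps_nth (infsum ?g UNIV) m"
    unfolding u0 by (rule nth[symmetric])
  finally show "fps_nth (infsum ?f UNIV) m = fps_nth (infsum ?g UNIV) m" .
qed

end

subsection \<open>Lambert series and the numerators\<close>

text \<open>The negative binomial series: by Pascal's rule, 1 - q^n times the series for k + 1 is
  the series for k.\<close>

lemma qgeom_power_infsum: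
  assumes "0 < n"
  shows "qgeom n ^ Suc k = infsum (\<lambda>j. fps_X ^ (j * n) * of_nat ((j + k) choose k)) UNIV"
proof (induction k)
  case 0
  show ?case using infsum_geometric[OF assms] by simp
next
  case (Suc k)
  define F where "F k = (\<lambda>j. fps_X ^ (j * n) * of_nat ((j + k) choose k) :: rat fps)" for k
  have fin: "coeff_finite (F k) UNIV" for k
    unfolding F_def by (rule coeff_finite_power_nat[OF assms])
  have finS: "coeff_finite (\<lambda>j. F k (Suc j)) UNIV" for k
  proof -
    have "coeff_finite (\<lambda>j. fps_X ^ n * (fps_X ^ (j * n) * of_nat ((Suc j + k) choose k))) UNIV"
      by (rule coeff_finite_cmult, rule coeff_finite_power_nat[OF assms])
    thus ?thesis by (simp add: F_def power_add mult.assoc)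
  qed
  have S: "infsum (F k) UNIV = 1 + infsum (\<lambda>j. F k (Suc j)) UNIV" for k
    by (subst infsum_fps_Suc[OF fin]) (simp add: F_def)
  have "infsum (F (Suc k)) UNIV - fps_X ^ n * infsum (F (Suc k)) UNIV
      = 1 + (infsum (\<lambda>j. F (Suc k) (Suc j)) UNIV - infsum (\<lambda>j. fps_X ^ n * F (Suc k) j) UNIV)"
    by (subst S) (simp add: infsum_fps_cmult[OF fin])
  also have "infsum (\<lambda>j. F (Suc k) (Suc j)) UNIV - infsum (\<lambda>j. fps_X ^ n * F (Suc k) j) UNIV
      = infsum (\<lambda>j. F (Suc k) (Suc j) - fps_X ^ n * F (Suc k) j) UNIV"
    by (rule infsum_fps_diff[OF finS coeff_finite_cmult[OF fin], symmetric])
  also have "\<dots> = infsum (\<lambda>j. F k (Suc j)) UNIV"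
  proof (rule infsum_cong)
    fix j
    have "(Suc j + Suc k) choose Suc k = ((Suc j + k) choose k) + ((j + Suc k) choose Suc k)"
      by simp
    thus "F (Suc k) (Suc j) - fps_X ^ n * F (Suc k) j = F k (Suc j)"
      by (simp add: F_def power_add algebra_simps del: binomial_Suc_Suc)
  qed
  finally have "(1 - fps_X ^ n) * infsum (F (Suc k)) UNIV = qgeom n ^ Suc k"
    using S[of k] Suc.IH by (simp add: F_def algebra_simps)
  hence "qgeom n ^ Suc (Suc k) = qgeom n * ((1 - fps_X ^ n) * infsum (F (Suc k)) UNIV)"
    by (simp only: power_Suc)
  also have "\<dots> = ((1 - fps_X ^ n) * qgeom n) * infsum (F (Suc k)) UNIV"
    by (simp only: mult_ac)
  finally show ?case by (simp only: qgeom_mult[OF assms] mult_1_left F_def)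
qed

text \<open>Both sides are the double sum of c_j q^((i+1)(j+1)), taken in the two orders.\<close>

lemma infsum_Lambert:
  fixes c :: "nat \<Rightarrow> nat"
  shows "infsum (\<lambda>i. fps_X ^ Suc i * infsum (\<lambda>j. fps_X ^ (j * Suc i) * of_nat (c j)) UNIV) UNIV
    = infsum (\<lambda>j. of_nat (c j) * fps_X ^ Suc j * qgeom (Suc j)) UNIV"
proof -
  define F where "F i j = (fps_X ^ (Suc i * Suc j) * of_nat (c j) :: rat fps)" for i j
  have fin: "coeff_finite (\<lambda>(i, j). F i j) (UNIV \<times> UNIV)"
  proof -
    have "coeff_finite (\<lambda>p. fps_X ^ (Suc (fst p) * Suc (snd p)) * of_nat (c (snd p))) (UNIV \<times> UNIV)"
    proof (rule coeff_finite_X_power)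
      fix m
      have "{p \<in> UNIV \<times> UNIV. Suc (fst p) * Suc (snd p) \<le> m} \<subseteq> {..m} \<times> {..m}"
      proof (intro subsetI)
        fix p assume "p \<in> {p \<in> UNIV \<times> UNIV. Suc (fst p) * Suc (snd p) \<le> m}"
        hence "fst p \<le> m" "snd p \<le> m" by simp_all
        thus "p \<in> {..m} \<times> {..m}" by (simp add: mem_Times_iff)
      qed
      thus "finite {p \<in> UNIV \<times> UNIV. Suc (fst p) * Suc (snd p) \<le> m}"
        by (rule finite_subset) auto
    qed
    thus ?thesis by (simp only: F_def case_prod_unfold)
  qed
  have cf: "coeff_finite (\<lambda>j. fps_X ^ (j * Suc i) * G j) UNIV" for i G
    by (rule coeff_finite_power_nat) simp
  have "infsum (\<lambda>i. fps_X ^ Suc i * infsum (\<lambda>j. fps_X ^ (j * Suc i) * of_nat (c j)) UNIV) UNIV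
     = infsum (\<lambda>i. infsum (F i) UNIV) UNIV"
  proof (rule infsum_cong)
    fix i
    have "infsum (\<lambda>j. fps_X ^ Suc i * (fps_X ^ (j * Suc i) * of_nat (c j))) UNIV = infsum (F i) UNIV"
      by (rule infsum_cong) (simp add: F_def power_add mult_ac)
    thus "fps_X ^ Suc i * infsum (\<lambda>j. fps_X ^ (j * Suc i) * of_nat (c j)) UNIV = infsum (F i) UNIV"
      by (simp only: infsum_fps_cmult[OF cf])
  qed
  also have "\<dots> = infsum (\<lambda>j. infsum (\<lambda>i. F i j) UNIV) UNIV"
    by (rule infsum_fps_swap[OF fin])
  also have "\<dots> = infsum (\<lambda>j. of_nat (c j) * fps_X ^ Suc j * qgeom (Suc j)) UNIV"
  proof (rule infsum_cong)
    fix j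
    have "infsum (\<lambda>i. F i j) UNIV
        = infsum (\<lambda>i. of_nat (c j) * fps_X ^ Suc j * (fps_X ^ (i * Suc j) * 1)) UNIV"
      by (rule infsum_cong) (simp add: F_def power_add mult_ac)
    also have "\<dots> = of_nat (c j) * fps_X ^ Suc j * infsum (\<lambda>i. fps_X ^ (i * Suc j) * 1) UNIV"
      by (rule infsum_fps_cmult[OF cf])
    finally show "infsum (\<lambda>i. F i j) UNIV = of_nat (c j) * fps_X ^ Suc j * qgeom (Suc j)"
      by (simp only: mult_1_right infsum_geometric[OF zero_less_Suc])
  qed
  finally show ?thesis .
qed

lemma divide_1_minus_X_power: "0 < n \<Longrightarrow> f / (1 - fps_X ^ n) = f * qgeom n"
  unfolding qgeom_def by (rule fps_divide_unit) simp

lemma infsum_atLeast_1: "infsum F {1..} = infsum (\<lambda>n. F (Suc n)) UNIV"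
proof -
  have "n \<in> range Suc" if "n \<ge> 1" for n using that by (cases n) auto
  hence "{1..} = range Suc" by auto
  thus ?thesis using infsum_reindex[of Suc UNIV F] by (simp add: o_def)
qed

lemma Gamma_numerator_eq:
  "Gamma_numerator (Suc k) = infsum (\<lambda>j. of_nat (Suc j * ((j + k) choose k)) * fps_X ^ Suc j * qgeom (Suc j)) UNIV"
  unfolding Gamma_numerator_def infsum_atLeast_1
  by (simp add: divide_1_minus_X_power del: power_Suc of_nat_mult of_nat_Suc mult_Suc)

lemma zeta_q_Lambert_eq:
  "zeta_q_Lambert (Suc k) = infsum (\<lambda>j. of_nat ((j + k) choose k) * fps_X ^ Suc j * qgeom (Suc j)) UNIV"
  unfolding zeta_q_Lambert_def infsum_atLeast_1
  by (simp add: divide_1_minus_X_power del: power_Suc)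

lemma zeta_q_eq: "zeta_q k = infsum (\<lambda>i. fps_X ^ Suc i * qgeom (Suc i) ^ k) UNIV"
proof -
  have "f / (1 - fps_X ^ n) ^ k = f * qgeom n ^ k" if "0 < n" for n and f :: "rat fps"
    using that unfolding qgeom_def fps_inverse_power[symmetric]
    by (intro fps_divide_unit) (simp add: fps_nth_power_0 zero_power)
  thus ?thesis
    unfolding zeta_q_def infsum_atLeast_1 by (simp del: power_Suc)
qed

lemma zeta_q_eq_Lambert: "zeta_q (Suc k) = zeta_q_Lambert (Suc k)"
  unfolding zeta_q_eq zeta_q_Lambert_eq qgeom_power_infsum[OF zero_less_Suc] by (rule infsum_Lambert)

lemma Gamma_numerator_eq_nested:
  "Gamma_numerator (Suc k) = infsum (\<lambda>n. fps_X ^ Suc n * (qgeom (Suc n) ^ 2 * qhom k (Suc n))) UNIV"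
proof -
  have cf: "coeff_finite (\<lambda>j. fps_X ^ (j * Suc i) * G j) UNIV" for i G
    by (rule coeff_finite_power_nat) simp
  have "of_nat (Suc k) * qgeom (Suc i) ^ Suc (Suc k) - of_nat k * qgeom (Suc i) ^ Suc k
      = infsum (\<lambda>j. fps_X ^ (j * Suc i) * of_nat (Suc j * ((j + k) choose k))) UNIV" for i
  proof -
    have "of_nat (Suc k) * qgeom (Suc i) ^ Suc (Suc k) - of_nat k * qgeom (Suc i) ^ Suc k
      = infsum (\<lambda>j. of_nat (Suc k) * (fps_X ^ (j * Suc i) * of_nat ((j + Suc k) choose Suc k))
          - of_nat k * (fps_X ^ (j * Suc i) * of_nat ((j + k) choose k))) UNIV"
      by (simp only: qgeom_power_infsum[OF zero_less_Suc] infsum_fps_diff infsum_fps_cmult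
            cf coeff_finite_cmult)
    also have "\<dots> = infsum (\<lambda>j. fps_X ^ (j * Suc i) * of_nat (Suc j * ((j + k) choose k))) UNIV"
    proof (rule infsum_cong)
      fix j
      \<comment> \<open>Absorption: the left side is (j + k + 1) binom(j + k, k). Removing k copies
        of the binomial leaves the weight j + 1.\<close>
      have "Suc k * ((j + Suc k) choose Suc k) = Suc j * ((j + k) choose k) + k * ((j + k) choose k)"
        using Suc_times_binomial[of k "j + k"] by (simp add: algebra_simps del: binomial_Suc_Suc)
      hence "of_nat (Suc k) * of_nat ((j + Suc k) choose Suc k)
          = (of_nat (Suc j * ((j + k) choose k)) + of_nat k * of_nat ((j + k) choose k) :: rat fps)"
        by (simp only: flip: of_nat_mult of_nat_add)
      thus "of_nat (Suc k) * (fps_X ^ (j * Suc i) * of_nat ((j + Suc k) choose Suc k))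
          - of_nat k * (fps_X ^ (j * Suc i) * of_nat ((j + k) choose k))
          = (fps_X ^ (j * Suc i) * of_nat (Suc j * ((j + k) choose k)) :: rat fps)"
        by (simp only: mult.left_commute[of "of_nat _"] flip: right_diff_distrib) simp
    qed
    finally show ?thesis .
  qed
  thus ?thesis
    unfolding Gamma_numerator_eq nested_sum_eq by (simp only: infsum_Lambert)
qed


section \<open>The logarithmic derivative of the product\<close>

lemma X_mult_deriv_qgeom_power:
  "fps_X * fps_deriv (qgeom (Suc j) ^ c)
     = qgeom (Suc j) ^ c * (of_nat (Suc j * c) * fps_X ^ Suc j * qgeom (Suc j))"
proof -
  let ?w = "qgeom (Suc j)"
  have "fps_deriv ?w = of_nat (Suc j) * fps_X ^ j * ?w ^ 2"
    unfolding qgeom_def by (subst fps_inverse_deriv) (simp_all add: fps_deriv_power' fps_of_nat del: power_Suc of_nat_Suc)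
  hence w: "fps_X * fps_deriv ?w = of_nat (Suc j) * fps_X ^ Suc j * ?w ^ 2"
    by (simp add: mult_ac)
  show ?thesis
  proof (cases c)
    case (Suc d)
    have "fps_X * fps_deriv (?w ^ c) = of_nat c * ?w ^ d * (fps_X * fps_deriv ?w)"
      unfolding fps_deriv_power' Suc diff_Suc_1 by (simp only: mult_ac)
    also have "\<dots> = ?w ^ c * (of_nat (Suc j * c) * fps_X ^ Suc j * ?w)"
      unfolding w Suc of_nat_mult power2_eq_square power_Suc[of ?w] by (simp only: mult_ac)
    finally show ?thesis .
  qed simp
qed

text \<open>Logarithmic derivatives add up over the partial products \<open>Q n\<close>. The limit
  is taken coefficientwise: q d/dq multiplies coefficient m by m, so it only sees coefficient m of
  the product, which \<open>Q n\<close> already has for n \<ge> m.\<close>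

lemma q_log_deriv_Gamma_product: "q_log_deriv (Gamma_product (Suc k)) = Gamma_numerator (Suc k)"
proof -
  define c where "c m = (m + k) choose k" for m
  define f where "f m = qgeom (Suc m) ^ c m" for m
  define s where "s m = of_nat (Suc m * c m) * fps_X ^ Suc m * qgeom (Suc m)" for m
  define P where "P = prodinf f"
  define Q where "Q n = (\<Prod>i\<le>n. f i)" for n
  have f1: "\<exists>g. f m = 1 + fps_X ^ Suc m * g" for m
  proof -
    have 1: "qgeom (Suc m) - 1 = fps_X ^ Suc m * qgeom (Suc m)"
      using qgeom_mult[of "Suc m"] by (simp add: algebra_simps)
    \<comment> \<open>A power w^c - 1 is a multiple of w - 1, and here w - 1 is divisible by
      q^(m+1).\<close>
    have 2: "f m - 1 = (qgeom (Suc m) - 1) * (\<Sum>i<c m. qgeom (Suc m) ^ i)"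
      unfolding f_def by (rule power_diff_1_eq)
    have "f m = 1 + (f m - 1)" by simp
    thus ?thesis unfolding 2 1 mult.assoc by blast
  qed
  have "Gamma_product (Suc k) = P"
    unfolding Gamma_product_def P_def
  proof (rule arg_cong[where f = prodinf], rule ext)
    fix m
    have "(1 - fps_X ^ Suc m) powi (- int n) = qgeom (Suc m) ^ n" for n
      by (cases "n = 0") (auto simp: power_int_def qgeom_def)
    thus "(1 - fps_X ^ Suc m) powi - int (Suc m + Suc k - 2 choose (Suc k - 1)) = f m"
      by (simp add: f_def c_def)
  qed
  moreover have PQ: "fps_nth P m = fps_nth (Q n) m" if "m \<le> n" for m n
    unfolding P_def Q_def by (rule prodinf_fps_nth[OF f1 that])
  have dQ: "fps_X * fps_deriv (Q n) = Q n * (\<Sum>i\<le>n. s i)" for n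
  proof (induction n)
    case 0
    show ?case by (simp only: Q_def f_def s_def atMost_0 prod.insert sum.insert) (simp add: X_mult_deriv_qgeom_power)
  next
    case (Suc n)
    have "fps_X * fps_deriv (Q (Suc n)) = Q n * (fps_X * fps_deriv (f (Suc n))) + (fps_X * fps_deriv (Q n)) * f (Suc n)"
      by (simp add: Q_def algebra_simps)
    also have "fps_X * fps_deriv (f (Suc n)) = f (Suc n) * s (Suc n)"
      unfolding f_def s_def by (rule X_mult_deriv_qgeom_power)
    finally show ?case unfolding Suc.IH by (simp add: Q_def algebra_simps)
  qed
  have S: "Gamma_numerator (Suc k) = infsum s UNIV"
    unfolding Gamma_numerator_eq s_def c_def ..
  have fin: "coeff_finite s UNIV"
    using coeff_finite_X_power_Suc[of "\<lambda>m. of_nat (Suc m * c m) * qgeom (Suc m)"]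
    by (simp only: s_def[abs_def] mult_ac)
  have S_nth: "fps_nth (infsum s UNIV) m = fps_nth (\<Sum>i\<le>n. s i) m" if "m \<le> n" for m n
    unfolding fps_sum_nth
  proof (rule infsum_fps_nth_superset[OF fin])
    fix i assume "i \<in> UNIV - {..n}"
    hence "m < Suc i" using that by auto
    moreover have "s i = fps_X ^ Suc i * (of_nat (Suc i * c i) * qgeom (Suc i))"
      by (simp only: s_def mult_ac)
    ultimately show "fps_nth (s i) m = 0" by (simp add: fps_X_power_mult_nth del: power_Suc)
  qed auto
  have "fps_X * fps_deriv P = P * infsum s UNIV"
  proof (rule fps_ext)
    fix m
    have "fps_nth (fps_X * fps_deriv P) m = fps_nth (fps_X * fps_deriv (Q m)) m"
      using PQ[of m m] by (cases m) simp_all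
    also have "\<dots> = fps_nth (Q m * (\<Sum>i\<le>m. s i)) m" by (simp only: dQ)
    also have "\<dots> = fps_nth (P * infsum s UNIV) m"
      unfolding fps_mult_nth
      by (intro sum.cong refl arg_cong2[where f = "(*)"] PQ[symmetric] S_nth[symmetric]) auto
    finally show "fps_nth (fps_X * fps_deriv P) m = fps_nth (P * infsum s UNIV) m" .
  qed
  moreover have "P \<noteq> 0"
  proof
    assume "P = 0"
    hence "fps_nth (f 0) 0 = 0" using PQ[of 0 0] by (simp add: Q_def)
    moreover obtain g where "f 0 = 1 + fps_X ^ Suc 0 * g" using f1 by blast
    ultimately show False by simp
  qed
  ultimately show ?thesis
    unfolding q_log_deriv_def S by simp
qed

section \<open>The factor 1/q and the final identities\<close>

text \<open>The prefactor 1/q lives in Laurent series, whereas the evaluations above concern a power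
  series \<open>R\<close>. The numerator is q times \<open>R\<close>, since its sums start with q^1
  where those of the graph series start with q^0.\<close>

lemma fls_graph_series_eq:
  assumes "H = inverse qpoch_inf ^ n * R" "N = fps_X * R"
  shows "fps_to_fls H = fls_X_inv * (fps_to_fls N / fps_to_fls qpoch_inf ^ n)"
proof -
  have "fps_to_fls qpoch_inf * fps_to_fls (inverse qpoch_inf) = 1"
    by (simp only: fls_times_fps_to_fls[symmetric] qpoch_inf_inverse fps_one_to_fls)
  hence "fps_to_fls (inverse qpoch_inf) = inverse (fps_to_fls qpoch_inf)"
    by (metis inverse_unique)
  hence "fps_to_fls H = inverse (fps_to_fls qpoch_inf) ^ n * fps_to_fls R"
    by (simp only: assms fls_times_fps_to_fls fps_to_fls_power)
  moreover have "fps_to_fls N = fls_X * fps_to_fls R"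
    by (simp only: assms fls_times_fps_to_fls fps_X_to_fls)
  moreover have "fls_X_inv * (fls_X :: rat fls) = 1"
    by (metis fls_inverse_X_inv fls_X_inv_nonzero right_inverse)
  ultimately show ?thesis
    by (simp add: divide_inverse power_inverse mult.assoc[symmetric] mult.commute)
qed

lemma graph_series_Gamma_eq:
  assumes "k \<ge> 1"
  shows "fps_to_fls (graph_series (3 * k + 2) (Gamma_edges k)) =
    fls_X_inv * (fps_to_fls (Gamma_numerator k) / fps_to_fls qpoch_inf ^ (k + 1))"
proof -
  obtain p where k: "k = Suc p" using assms by (cases k) auto
  have fin: "coeff_finite (\<lambda>m. fps_X ^ m * (qgeom (Suc m) ^ 2 * qhom p (Suc m))) UNIV"
    by (rule coeff_finite_X_power) simp
  have "Gamma_numerator k = fps_X * infsum (\<lambda>m. fps_X ^ m * (qgeom (Suc m) ^ 2 * qhom p (Suc m))) UNIV"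
    unfolding k Gamma_numerator_eq_nested infsum_fps_cmult[OF fin, symmetric]
    by (simp only: power_Suc mult.assoc)
  thus ?thesis
    using graph_series_Gamma_chain[of p] unfolding k
    by (intro fls_graph_series_eq) (simp_all only: mult.assoc Suc_eq_plus1)
qed

lemma graph_series_T_eq:
  "fps_to_fls (graph_series (2 * k + 2) (T_edges k)) =
    fls_X_inv * (fps_to_fls (zeta_q k) / fps_to_fls qpoch_inf ^ (k + 1))"
proof (rule fls_graph_series_eq)
  have fin: "coeff_finite (\<lambda>n. fps_X ^ n * qgeom (Suc n) ^ k) UNIV"
    by (rule coeff_finite_X_power) simp
  show "zeta_q k = fps_X * infsum (\<lambda>n. fps_X ^ n * qgeom (Suc n) ^ k) UNIV"
    unfolding zeta_q_eq infsum_fps_cmult[OF fin, symmetric] by (simp only: power_Suc mult.assoc)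
qed (simp only: graph_series_T Suc_eq_plus1)

theorem theorem1p1:
  shows "(\<forall>k\<ge>1.
            fps_to_fls (graph_series (3 * k + 2) (Gamma_edges k)) =
              fls_X_inv * (fps_to_fls (Gamma_numerator k) / fps_to_fls qpoch_inf ^ (k + 1))
            \<and> Gamma_numerator k = q_log_deriv (Gamma_product k))
       \<and> (\<forall>k\<ge>2.
            fps_to_fls (graph_series (2 * k + 2) (T_edges k)) =
              fls_X_inv * (fps_to_fls (zeta_q k) / fps_to_fls qpoch_inf ^ (k + 1))
            \<and> zeta_q k = zeta_q_Lambert k)"
proof (intro conjI allI impI)
  fix k :: nat assume "1 \<le> k"
  thus "fps_to_fls (graph_series (3 * k + 2) (Gamma_edges k)) =
      fls_X_inv * (fps_to_fls (Gamma_numerator k) / fps_to_fls qpoch_inf ^ (k + 1))"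
    by (rule graph_series_Gamma_eq)
  show "Gamma_numerator k = q_log_deriv (Gamma_product k)"
    using \<open>1 \<le> k\<close> q_log_deriv_Gamma_product by (cases k) simp_all
next
  fix k :: nat assume "2 \<le> k"
  show "fps_to_fls (graph_series (2 * k + 2) (T_edges k)) =
      fls_X_inv * (fps_to_fls (zeta_q k) / fps_to_fls qpoch_inf ^ (k + 1))"
    by (rule graph_series_T_eq)
  show "zeta_q k = zeta_q_Lambert k"
    using \<open>2 \<le> k\<close> zeta_q_eq_Lambert by (cases k) simp_all
qed

end
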